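(* Let $G$ be a connected graph on $n\geq 3$ vertices with Randić index $R$, algebraic connectivity $a$, diameter $D$ and minimum degree $\delta$. Then $$R\cdot a\geq \frac{8\sqrt{n-1}}{nD^2}\qquad\text{and}\qquad R\cdot a\geq \frac{n\delta(2\delta-n+2)}{2(n-1)}.$$ Moreover, if $D\leq (n-1)^{1/4}$ or $\delta\geq \frac{n}{2}-1$, then $R(G)\cdot a(G)\geq R(P_n)\cdot a(P_n)$, i.e., the path $P_n$ minimizes $R\cdot a$ in comparison with such graphs.
   Context: For a graph $G=(V,E)$, the Randić index is $R(G)=\sum_{uv\in E(G)}\frac{1}{\sqrt{d(u)d(v)}}$, where $d(u)$ is the degree of $u$. The algebraic connectivity $a(G)$ is the second smallest eigenvalue of the Laplacian matrix $L(G)=D(G)-A(G)$ (diagonal degree matrix minus adjacency matrix). The diameter $D$ is the maximum distance between two vertices, $\delta$ is the minimum vertex degree, and $P_n$ is the path on $n$ vertices, for which $R(P_n)=\frac{n-3+2\sqrt2}{2}$ and $a(P_n)=2(1-\cos\frac{\pi}{n})$. *)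

theory Defs
  imports "HOL-Analysis.Analysis" "Jordan_Normal_Form.Char_Poly"
begin

definition simple_graph :: "nat \<Rightarrow> (nat \<Rightarrow> nat \<Rightarrow> bool) \<Rightarrow> bool" where
  "simple_graph n E \<longleftrightarrow>
     (\<forall>u v. E u v \<longrightarrow> u < n \<and> v < n) \<and>
     (\<forall>u v. E u v \<longrightarrow> E v u) \<and>
     (\<forall>u. \<not> E u u)"

definition deg :: "nat \<Rightarrow> (nat \<Rightarrow> nat \<Rightarrow> bool) \<Rightarrow> nat \<Rightarrow> nat" where
  "deg n E u = card {v. v < n \<and> E u v}"

definition min_degree :: "nat \<Rightarrow> (nat \<Rightarrow> nat \<Rightarrow> bool) \<Rightarrow> nat" where
  "min_degree n E = Min (deg n E ` {0..<n})"

definition walk :: "nat \<Rightarrow> (nat \<Rightarrow> nat \<Rightarrow> bool) \<Rightarrow> nat list \<Rightarrow> bool" where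
  "walk n E xs \<longleftrightarrow> xs \<noteq> [] \<and> (\<forall>x\<in>set xs. x < n) \<and>
     (\<forall>i. Suc i < length xs \<longrightarrow> E (xs ! i) (xs ! Suc i))"

definition connected_graph :: "nat \<Rightarrow> (nat \<Rightarrow> nat \<Rightarrow> bool) \<Rightarrow> bool" where
  "connected_graph n E \<longleftrightarrow>
     (\<forall>u<n. \<forall>v<n. \<exists>xs. walk n E xs \<and> hd xs = u \<and> last xs = v)"

definition gdist :: "nat \<Rightarrow> (nat \<Rightarrow> nat \<Rightarrow> bool) \<Rightarrow> nat \<Rightarrow> nat \<Rightarrow> nat" where
  "gdist n E u v = (LEAST k. \<exists>xs. walk n E xs \<and> hd xs = u \<and> last xs = v \<and> length xs = Suc k)"

definition diameter :: "nat \<Rightarrow> (nat \<Rightarrow> nat \<Rightarrow> bool) \<Rightarrow> nat" where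
  "diameter n E = Max {gdist n E u v | u v. u < n \<and> v < n}"

definition randic :: "nat \<Rightarrow> (nat \<Rightarrow> nat \<Rightarrow> bool) \<Rightarrow> real" where
  "randic n E = (\<Sum>(u,v)\<in>{(u,v). u < v \<and> v < n \<and> E u v}.
                    1 / sqrt (real (deg n E u) * real (deg n E v)))"

definition laplacian :: "nat \<Rightarrow> (nat \<Rightarrow> nat \<Rightarrow> bool) \<Rightarrow> real mat" where
  "laplacian n E = mat n n (\<lambda>(i,j). (if i = j then real (deg n E i) else 0)
                                      - (if E i j then 1 else 0))"

text \<open>Laplacian eigenvalues with multiplicity, sorted increasingly
  (roots of the characteristic polynomial; all real since L is symmetric).\<close>
definition laplacian_spectrum :: "nat \<Rightarrow> (nat \<Rightarrow> nat \<Rightarrow> bool) \<Rightarrow> real list" where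
  "laplacian_spectrum n E = sorted_list_of_multiset (proots (char_poly (laplacian n E)))"

definition alg_conn :: "nat \<Rightarrow> (nat \<Rightarrow> nat \<Rightarrow> bool) \<Rightarrow> real" where
  "alg_conn n E = laplacian_spectrum n E ! 1"

definition path_graph :: "nat \<Rightarrow> nat \<Rightarrow> nat \<Rightarrow> bool" where
  "path_graph n u v \<longleftrightarrow> u < n \<and> v < n \<and> (v = Suc u \<or> u = Suc v)"

end

theory Submission
  imports Defs "Jordan_Normal_Form.Schur_Decomposition"
begin

text \<open>Write \<open>Q f\<close> for the Dirichlet form, the sum of \<open>(f u - f v)\<^sup>2\<close> over all edges. Since
  \<open>\<surd>(i j) / (i + j)\<close> is smallest when the ratio of \<open>i\<close> and \<open>j\<close> is most extreme, and the sum of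
  \<open>1/d(u) + 1/d(v)\<close> over all edges is \<open>n\<close>, the Randic index is at least \<open>\<surd>(n - 1)\<close>. Following a
  geodesic between the extreme values of a vector orthogonal to the constants, Cauchy-Schwarz and
  Popoviciu's inequality give \<open>a \<ge> 4 / (n D)\<close>; complementation gives \<open>a \<ge> 2 \<delta> - n + 2\<close>. For the path,
  \<open>R a \<le> 6 (n - 3 + 2 \<surd>2) / (n (n + 1))\<close>. The only delicate comparison is \<open>2 \<delta> = n - 2\<close>, where the
  diameter is at most 3: if it is at most 2 then \<open>a \<ge> 2 / (n - 1)\<close>, and otherwise
  \<open>a \<ge> 4 / (3 n - 5)\<close> while the degrees differ at most by a factor 2, which improves the bound
  on \<open>R\<close>; \<open>n = 4\<close> is treated exactly.\<close>

section \<open>Eigenvectors of symmetric matrices\<close>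

lemma symmetric_eigenvalue_real:
  fixes A :: "real mat"
  assumes A: "A \<in> carrier_mat n n"
    and sym: "\<And>i j. i < n \<Longrightarrow> j < n \<Longrightarrow> A $$ (i,j) = A $$ (j,i)"
    and ev: "eigenvalue (map_mat complex_of_real A) a"
  shows "a \<in> \<real>"
proof -
  let ?C = "map_mat complex_of_real A"
  obtain v where v: "v \<in> carrier_vec n" "v \<noteq> 0\<^sub>v n" and Cv: "?C *\<^sub>v v = a \<cdot>\<^sub>v v"
    using ev A unfolding eigenvalue_def eigenvector_def by auto
  define x where "x i = vec_index v i" for i
  define S where "S = (\<Sum>i<n. \<Sum>j<n. cnj (x i) * (of_real (A $$ (i,j)) * x j))"
  define N where "N = (\<Sum>i<n. (cmod (x i))\<^sup>2)"
  have row: "(\<Sum>j<n. of_real (A $$ (i,j)) * x j) = a * x i" if "i < n" for i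
  proof -
    have "vec_index (?C *\<^sub>v v) i = (\<Sum>j<n. of_real (A $$ (i,j)) * x j)"
      using that A v by (simp add: scalar_prod_def x_def atLeast0LessThan)
    then show ?thesis unfolding Cv using that v by (simp add: x_def)
  qed
  have "S = (\<Sum>i<n. cnj (x i) * (a * x i))"
    unfolding S_def by (intro sum.cong refl) (simp add: sum_distrib_left[symmetric] row)
  also have "\<dots> = a * of_real N"
    unfolding N_def of_real_sum sum_distrib_left
    by (intro sum.cong refl) (simp add: complex_norm_square[unfolded of_real_power] mult_ac)
  finally have S: "S = a * of_real N" .
  have "cnj S = (\<Sum>i<n. \<Sum>j<n. cnj (x j) * (of_real (A $$ (i,j)) * x i))"
    unfolding S_def by (simp add: mult_ac)
  also have "\<dots> = S"
    unfolding S_def by (subst sum.swap) (intro sum.cong refl, simp add: sym)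
  finally have "cnj a * of_real N = a * of_real N" unfolding S by simp
  moreover have "N \<noteq> 0"
  proof
    assume "N = 0"
    then have "\<forall>i<n. x i = 0" unfolding N_def by (simp add: sum_nonneg_eq_0_iff)
    then have "v = 0\<^sub>v n" using v by (intro eq_vecI) (auto simp: x_def)
    with v show False by simp
  qed
  ultimately have "cnj a = a" by simp
  then show ?thesis by (simp add: complex_is_Real_iff complex_eq_iff)
qed

lemma symmetric_char_poly_splits:
  fixes A :: "real mat"
  assumes A: "A \<in> carrier_mat n n"
    and sym: "\<And>i j. i < n \<Longrightarrow> j < n \<Longrightarrow> A $$ (i,j) = A $$ (j,i)"
  shows "\<exists>es. char_poly A = (\<Prod>e\<leftarrow>es. [:- e, 1:]) \<and> length es = n"
proof -
  let ?C = "map_mat complex_of_real A"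
  have C: "?C \<in> carrier_mat n n" using A by simp
  obtain as where as: "char_poly ?C = (\<Prod>a\<leftarrow>as. [:- a, 1:])" "length as = n"
    using char_poly_factorized[OF C] by auto
  have real: "complex_of_real (Re a) = a" if "a \<in> set as" for a
  proof -
    have "poly (char_poly ?C) a = 0"
      unfolding as poly_prod_list using that by (force simp: prod_list_zero_iff)
    then have "eigenvalue ?C a" using eigenvalue_root_char_poly[OF C] by simp
    then show ?thesis using symmetric_eigenvalue_real[OF A sym] by simp
  qed
  interpret h: map_poly_comm_ring_hom complex_of_real
    by (unfold_locales) auto
  have "map_poly complex_of_real (\<Prod>e\<leftarrow>map Re as. [:- e, 1:])
      = (\<Prod>a\<leftarrow>as. [:- complex_of_real (Re a), 1:])"
    by (simp add: h.hom_prod_list o_def map_poly_pCons)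
  also have "\<dots> = (\<Prod>a\<leftarrow>as. [:- a, 1:])"
    by (intro arg_cong[of _ _ prod_list] map_cong refl) (simp add: real)
  also have "\<dots> = map_poly complex_of_real (char_poly A)"
    using of_real_hom.char_poly_hom[OF A, where ?'a = complex] as(1) by metis
  finally have "char_poly A = (\<Prod>e\<leftarrow>map Re as. [:- e, 1:])"
    by (metis (mono_tags, lifting) coeff_map_poly of_real_0 of_real_eq_iff poly_eqI)
  then show ?thesis using as(2) by (metis length_map)
qed

lemma proots_linear_factors:
  "proots (\<Prod>e\<leftarrow>es. [:- e, 1:]) = mset es" for es :: "real list"
proof (induction es)
  case (Cons e es)
  have "(\<Prod>e\<leftarrow>es. [:- e, 1:]) \<noteq> 0" by (auto simp: prod_list_zero_iff)
  then have "proots ([:- e, 1:] * (\<Prod>e\<leftarrow>es. [:- e, 1:])) = {#e#} + mset es"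
    by (subst proots_mult) (auto simp: Cons)
  then show ?case by (simp del: mult_pCons_left)
qed simp

text \<open>Schur's triangular form makes the span of the first two columns \<open>p\<close>, \<open>r\<close> of the
  transformation invariant; replacing \<open>r\<close> by its component orthogonal to \<open>p\<close> diagonalises
  the restriction, because the matrix is symmetric.\<close>
lemma symmetric_two_eigenvectors:
  fixes A :: "real mat"
  assumes A: "A \<in> carrier_mat n n"
    and sym: "\<And>i j. i < n \<Longrightarrow> j < n \<Longrightarrow> A $$ (i,j) = A $$ (j,i)"
    and c: "char_poly A = (\<Prod>e\<leftarrow>es. [:- e, 1:])" and n: "2 \<le> n"
  obtains p q :: "nat \<Rightarrow> real"
    where "\<exists>i<n. p i \<noteq> 0" "\<exists>i<n. q i \<noteq> 0" "(\<Sum>i<n. p i * q i) = 0"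
      "\<And>i. i < n \<Longrightarrow> (\<Sum>j<n. A $$ (i,j) * p j) = es ! 0 * p i"
      "\<And>i. i < n \<Longrightarrow> (\<Sum>j<n. A $$ (i,j) * q j) = es ! 1 * q i"
proof -
  obtain B P Q where dec: "schur_decomposition A es = (B,P,Q)"
    by (cases "schur_decomposition A es") auto
  have sw: "similar_mat_wit A B P Q" and ut: "upper_triangular B" and dg: "diag_mat B = es"
    using schur_decomposition[OF A c dec] by auto
  note w = similar_mat_witD2[OF A sw]
  have car: "B \<in> carrier_mat n n" "P \<in> carrier_mat n n" "Q \<in> carrier_mat n n" using w by auto
  have "A * P = P * B * (Q * P)"
    using w(3) car by (simp add: assoc_mult_mat[of _ n n _ n _ n])
  then have AP: "A * P = P * B" using w(2) car by simp
  have es: "es ! 0 = B $$ (0,0)" "es ! 1 = B $$ (1,1)"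
    unfolding dg[symmetric] diag_mat_def using car n by auto
  define p where "p i = P $$ (i,0)" for i
  define r where "r i = P $$ (i,1)" for i
  define b where "b = B $$ (0,1)"
  have "(\<Sum>j<n. A $$ (i,j) * P $$ (j,k)) = (\<Sum>j<n. P $$ (i,j) * B $$ (j,k))"
    if "i < n" "k < n" for i k
  proof -
    have "(A * P) $$ (i,k) = (P * B) $$ (i,k)" by (simp add: AP)
    then show ?thesis using that A car by (simp add: scalar_prod_def atLeast0LessThan)
  qed note ent = this
  have Ap: "(\<Sum>j<n. A $$ (i,j) * p j) = es ! 0 * p i" if "i < n" for i
  proof -
    have "(\<Sum>j<n. P $$ (i,j) * B $$ (j,0)) = (\<Sum>j\<in>{0}. P $$ (i,j) * B $$ (j,0))"
      using ut car n by (intro sum.mono_neutral_right) (auto dest: upper_triangularD)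
    then show ?thesis using ent[OF that, of 0] n by (simp add: p_def es)
  qed
  have Ar: "(\<Sum>j<n. A $$ (i,j) * r j) = b * p i + es ! 1 * r i" if "i < n" for i
  proof -
    have "(\<Sum>j<n. P $$ (i,j) * B $$ (j,1)) = (\<Sum>j\<in>{0,1}. P $$ (i,j) * B $$ (j,1))"
      using upper_triangularD[OF ut, of 1] car n by (intro sum.mono_neutral_right) auto
    then show ?thesis using ent[OF that, of 1] n es(2) by (simp add: p_def r_def b_def)
  qed
  have QP: "(\<Sum>j<n. Q $$ (i,j) * P $$ (j,k)) = (if i = k then 1 else 0)"
    if "i < n" "k < n" for i k
  proof -
    have "(Q * P) $$ (i,k) = 1\<^sub>m n $$ (i,k)" using w(2) by simp
    then show ?thesis using that car by (simp add: scalar_prod_def atLeast0LessThan)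
  qed
  have p0: "\<exists>i<n. p i \<noteq> 0"
  proof (rule ccontr)
    assume "\<not> ?thesis"
    then have "(\<Sum>j<n. Q $$ (0,j) * P $$ (j,0)) = 0" by (intro sum.neutral) (auto simp: p_def)
    then show False using QP[of 0 0] n by simp
  qed
  define N where "N = (\<Sum>i<n. p i * p i)"
  have N: "N \<noteq> 0"
    using p0 unfolding N_def by (subst sum_nonneg_eq_0_iff) auto
  define t where "t = (\<Sum>i<n. p i * r i) / N"
  define q where "q i = r i - t * p i" for i
  have "(\<Sum>i<n. p i * q i) = (\<Sum>i<n. p i * r i) - t * N"
    by (simp add: q_def N_def right_diff_distrib sum_subtractf sum_distrib_left mult_ac)
  then have pq: "(\<Sum>i<n. p i * q i) = 0"
    using N by (simp add: t_def)
  define b' where "b' = b + t * (es ! 1 - es ! 0)"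
  have Aq: "(\<Sum>j<n. A $$ (i,j) * q j) = b' * p i + es ! 1 * q i" if "i < n" for i
  proof -
    have "(\<Sum>j<n. A $$ (i,j) * q j) = (\<Sum>j<n. A $$ (i,j) * r j) - t * (\<Sum>j<n. A $$ (i,j) * p j)"
      by (simp add: q_def right_diff_distrib sum_subtractf sum_distrib_left mult_ac)
    then show ?thesis using Ap[OF that] Ar[OF that] by (simp add: q_def b'_def algebra_simps)
  qed
  have "(\<Sum>i<n. p i * (b' * p i + es ! 1 * q i)) = b' * N + es ! 1 * (\<Sum>i<n. p i * q i)"
    by (simp add: N_def distrib_left sum.distrib sum_distrib_left mult_ac)
  then have "b' * N = (\<Sum>i<n. p i * (b' * p i + es ! 1 * q i))"
    using pq by simp
  also have "\<dots> = (\<Sum>i<n. \<Sum>j<n. p i * A $$ (i,j) * q j)"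
    by (intro sum.cong refl) (simp add: Aq[unfolded One_nat_def, symmetric] sum_distrib_left mult.assoc)
  also have "\<dots> = (\<Sum>j<n. q j * (\<Sum>i<n. A $$ (j,i) * p i))"
    by (subst sum.swap) (simp add: sum_distrib_left, intro sum.cong refl, simp add: sym mult_ac)
  also have "\<dots> = (\<Sum>j<n. q j * (es ! 0 * p j))"
    by (simp add: Ap)
  also have "\<dots> = es ! 0 * (\<Sum>j<n. p j * q j)"
    by (simp add: sum_distrib_left mult_ac)
  finally have b': "b' = 0" using N pq by simp
  have q0: "\<exists>i<n. q i \<noteq> 0"
  proof (rule ccontr)
    assume "\<not> ?thesis"
    then have "\<forall>j<n. P $$ (j,1) = t * P $$ (j,0)" by (auto simp: q_def p_def r_def)
    then have "(\<Sum>j<n. Q $$ (1,j) * P $$ (j,1)) = t * (\<Sum>j<n. Q $$ (1,j) * P $$ (j,0))"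
      by (simp add: sum_distrib_left mult_ac)
    then show False using QP[of 1 1] QP[of 1 0] n by simp
  qed
  show ?thesis using that[OF p0 q0 pq Ap] Aq b' by simp
qed

section \<open>Dirichlet form and algebraic connectivity\<close>

definition edge_sum :: "nat \<Rightarrow> (nat \<Rightarrow> nat \<Rightarrow> bool) \<Rightarrow> (nat \<Rightarrow> nat \<Rightarrow> real) \<Rightarrow> real" where
  "edge_sum n E w = (\<Sum>(u,v)\<in>{(u,v). u < v \<and> v < n \<and> E u v}. w u v)"

abbreviation dirichlet :: "nat \<Rightarrow> (nat \<Rightarrow> nat \<Rightarrow> bool) \<Rightarrow> (nat \<Rightarrow> real) \<Rightarrow> real" where
  "dirichlet n E f \<equiv> edge_sum n E (\<lambda>u v. (f u - f v)\<^sup>2)"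

lemma randic_eq_edge_sum:
  "randic n E = edge_sum n E (\<lambda>u v. 1 / sqrt (real (deg n E u) * real (deg n E v)))"
  by (simp add: randic_def edge_sum_def)

lemma simple_graphD:
  assumes "simple_graph n E"
  shows "E u v \<Longrightarrow> u < n" "E u v \<Longrightarrow> v < n" "E u v \<Longrightarrow> E v u" "\<not> E u u" "E u v \<longleftrightarrow> E v u"
  using assms unfolding simple_graph_def by blast+

lemma finite_edges: "finite {(u,v). u < v \<and> v < n \<and> E u (v::nat)}"
  by (rule finite_subset[of _ "{..<n} \<times> {..<n}"]) auto

lemma edge_sum_mono:
  assumes "\<And>u v. u < v \<Longrightarrow> v < n \<Longrightarrow> E u v \<Longrightarrow> w u v \<le> w' u v"
  shows "edge_sum n E w \<le> edge_sum n E w'"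
  unfolding edge_sum_def by (rule sum_mono) (use assms in auto)

lemma edge_sum_scale: "edge_sum n E (\<lambda>u v. c * w u v) = c * edge_sum n E w"
  unfolding edge_sum_def by (simp add: sum_distrib_left case_prod_unfold)

lemma edge_sum_arcs:
  assumes G: "simple_graph n E" and sym: "\<And>u v. w u v = w v u"
  shows "(\<Sum>(u,v)\<in>{(u,v). E u v}. w u v) = 2 * edge_sum n E w"
proof -
  let ?S = "{(u,v). u < v \<and> v < n \<and> E u v}"
  have split: "{(u,v). E u v} = ?S \<union> prod.swap ` ?S"
    using simple_graphD[OF G] by (auto simp: image_iff) (metis linorder_neqE_nat)+
  have "(\<Sum>(u,v)\<in>{(u,v). E u v}. w u v)
      = (\<Sum>(u,v)\<in>?S. w u v) + (\<Sum>(u,v)\<in>prod.swap ` ?S. w u v)"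
    unfolding split using finite_edges[of n E] by (intro sum.union_disjoint) auto
  also have "(\<Sum>(u,v)\<in>prod.swap ` ?S. w u v) = (\<Sum>(u,v)\<in>?S. w u v)"
    by (subst sum.reindex) (auto intro!: sum.cong simp: sym)
  finally show ?thesis by (simp add: edge_sum_def)
qed

lemma edge_sum_double:
  assumes G: "simple_graph n E" and sym: "\<And>u v. w u v = w v u"
  shows "2 * edge_sum n E w = (\<Sum>u<n. \<Sum>v<n. if E u v then w u v else 0)"
proof -
  have "(\<Sum>u<n. \<Sum>v<n. if E u v then w u v else 0)
      = (\<Sum>(u,v)\<in>{..<n} \<times> {..<n}. if E u v then w u v else 0)"
    by (simp add: sum.cartesian_product)
  also have "\<dots> = (\<Sum>(u,v)\<in>{(u,v). E u v}. w u v)"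
    by (rule sum.mono_neutral_cong_right) (auto split: if_splits dest: simple_graphD(1,2)[OF G])
  finally show ?thesis using edge_sum_arcs[OF assms] by simp
qed

lemma edge_sum_ge_arcs:
  assumes G: "simple_graph n E" and sym: "\<And>u v. w u v = w v u" and nn: "\<And>u v. w u v \<ge> 0"
    and F: "\<And>u v. (u,v) \<in> F \<Longrightarrow> E u v" "\<And>u v. (u,v) \<in> F \<Longrightarrow> (v,u) \<notin> F"
  shows "(\<Sum>(u,v)\<in>F. w u v) \<le> edge_sum n E w"
proof -
  let ?A = "{(u,v). E u v}"
  have finA: "finite ?A"
    by (rule finite_subset[of _ "{..<n} \<times> {..<n}"]) (auto dest: simple_graphD(1,2)[OF G])
  have finF: "finite F" using F(1) by (intro finite_subset[OF _ finA]) auto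
  have "2 * (\<Sum>(u,v)\<in>F. w u v) = (\<Sum>(u,v)\<in>F. w u v) + (\<Sum>(u,v)\<in>prod.swap ` F. w u v)"
    by (subst sum.reindex) (auto intro!: sum.cong simp: sym)
  also have "\<dots> = (\<Sum>(u,v)\<in>F \<union> prod.swap ` F. w u v)"
    using finF F(2) by (intro sum.union_disjoint[symmetric]) auto
  also have "\<dots> \<le> (\<Sum>(u,v)\<in>?A. w u v)"
    using finA F(1) nn simple_graphD(3)[OF G] by (intro sum_mono2) auto
  finally show ?thesis using edge_sum_arcs[OF G sym] by simp
qed

lemma deg_eq_sum: "real (deg n E u) = (\<Sum>v<n. if E u v then 1 else 0)"
  unfolding deg_def by (simp add: sum.If_cases Int_def)

lemma edge_sum_endpoints:
  assumes G: "simple_graph n E"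
  shows "edge_sum n E (\<lambda>u v. h u + h v) = (\<Sum>u<n. real (deg n E u) * h u)"
proof -
  have "2 * edge_sum n E (\<lambda>u v. h u + h v) = (\<Sum>u<n. \<Sum>v<n. if E u v then h u + h v else 0)"
    by (rule edge_sum_double[OF G]) simp
  also have "\<dots> = (\<Sum>u<n. \<Sum>v<n. if E u v then h u else 0) + (\<Sum>u<n. \<Sum>v<n. if E u v then h v else 0)"
    unfolding sum.distrib[symmetric] by (intro sum.cong refl) auto
  also have "(\<Sum>u<n. \<Sum>v<n. if E u v then h v else 0) = (\<Sum>v<n. \<Sum>u<n. if E v u then h v else 0)"
    by (subst sum.swap) (simp add: simple_graphD(5)[OF G])
  also have "(\<Sum>u<n. \<Sum>v<n. if E u v then h u else 0) = (\<Sum>u<n. real (deg n E u) * h u)"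
    unfolding deg_eq_sum sum_distrib_right by (intro sum.cong refl) auto
  finally show ?thesis by simp
qed

lemma laplacian_carrier: "laplacian n E \<in> carrier_mat n n"
  by (simp add: laplacian_def)

lemma laplacian_row:
  assumes "simple_graph n E" "i < n"
  shows "(\<Sum>j<n. laplacian n E $$ (i,j) * f j) = (\<Sum>j<n. if E i j then f i - f j else 0)"
proof -
  have "(\<Sum>j<n. laplacian n E $$ (i,j) * f j)
     = (\<Sum>j<n. (if j = i then real (deg n E i) * f i else 0) - (if E i j then f j else 0))"
    using assms simple_graphD(4)[OF assms(1)] by (intro sum.cong refl) (auto simp: laplacian_def)
  also have "\<dots> = real (deg n E i) * f i - (\<Sum>j<n. if E i j then f j else 0)"
    using assms by (simp add: sum_subtractf)
  also have "\<dots> = (\<Sum>j<n. if E i j then f i - f j else 0)"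
    unfolding deg_eq_sum sum_distrib_right sum_subtractf[symmetric] by (intro sum.cong refl) auto
  finally show ?thesis .
qed

lemma laplacian_form:
  assumes G: "simple_graph n E"
  shows "(\<Sum>i<n. f i * (\<Sum>j<n. laplacian n E $$ (i,j) * f j)) = dirichlet n E f"
proof -
  let ?T = "\<Sum>i<n. \<Sum>j<n. if E i j then f i * (f i - f j) else 0"
  have "2 * dirichlet n E f = (\<Sum>i<n. \<Sum>j<n. if E i j then (f i - f j)\<^sup>2 else 0)"
    by (rule edge_sum_double[OF G]) (simp add: power2_commute)
  also have "\<dots> = ?T + (\<Sum>i<n. \<Sum>j<n. if E i j then f j * (f j - f i) else 0)"
    unfolding sum.distrib[symmetric]
    by (intro sum.cong refl) (auto simp: power2_eq_square algebra_simps)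
  also have "(\<Sum>i<n. \<Sum>j<n. if E i j then f j * (f j - f i) else 0) = ?T"
    by (subst sum.swap) (simp add: simple_graphD(5)[OF G])
  also have "?T = (\<Sum>i<n. f i * (\<Sum>j<n. laplacian n E $$ (i,j) * f j))"
    by (intro sum.cong refl) (auto simp: laplacian_row[OF G] sum_distrib_left intro!: sum.cong)
  finally show ?thesis by simp
qed

lemma laplacian_spectrum_char_poly:
  assumes "simple_graph n E"
  shows "char_poly (laplacian n E) = (\<Prod>e\<leftarrow>laplacian_spectrum n E. [:- e, 1:])"
    and "length (laplacian_spectrum n E) = n" and "sorted (laplacian_spectrum n E)"
proof -
  have "laplacian n E $$ (i,j) = laplacian n E $$ (j,i)" if "i < n" "j < n" for i j
    using that simple_graphD(5)[OF assms] by (auto simp: laplacian_def)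
  from symmetric_char_poly_splits[OF laplacian_carrier this]
  obtain es where es: "char_poly (laplacian n E) = (\<Prod>e\<leftarrow>es. [:- e, 1:])" "length es = n"
    by blast
  then have spec: "laplacian_spectrum n E = sort es"
    by (simp add: laplacian_spectrum_def proots_linear_factors)
  have "(\<Prod>e\<leftarrow>es. [:- e, 1:]) = (\<Prod>e\<leftarrow>sort es. [:- e, 1:])"
    by (simp add: prod_mset_prod_list[symmetric])
  with es spec show "char_poly (laplacian n E) = (\<Prod>e\<leftarrow>laplacian_spectrum n E. [:- e, 1:])"
    "length (laplacian_spectrum n E) = n" "sorted (laplacian_spectrum n E)" by simp_all
qed

text \<open>A combination of the two lowest eigenvectors is orthogonal to the constants, and its
  Rayleigh quotient is at most the second eigenvalue.\<close>
lemma alg_conn_ge: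
  assumes G: "simple_graph n E" and n: "2 \<le> n"
    and ray: "\<And>f. (\<Sum>i<n. f i) = 0 \<Longrightarrow> c * (\<Sum>i<n. (f i)\<^sup>2) \<le> dirichlet n E f"
  shows "c \<le> alg_conn n E"
proof -
  let ?L = "laplacian n E" and ?es = "laplacian_spectrum n E"
  have "?L $$ (i,j) = ?L $$ (j,i)" if "i < n" "j < n" for i j
    using that simple_graphD(5)[OF G] by (auto simp: laplacian_def)
  from symmetric_two_eigenvectors[OF laplacian_carrier this laplacian_spectrum_char_poly(1)[OF G] n]
  obtain p q where p: "\<exists>i<n. p i \<noteq> 0" and q: "\<exists>i<n. q i \<noteq> 0" and pq: "(\<Sum>i<n. p i * q i) = 0"
    and Lp: "\<And>i. i < n \<Longrightarrow> (\<Sum>j<n. ?L $$ (i,j) * p j) = ?es ! 0 * p i"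
    and Lq: "\<And>i. i < n \<Longrightarrow> (\<Sum>j<n. ?L $$ (i,j) * q j) = ?es ! 1 * q i"
    by blast
  define P where "P = (\<Sum>i<n. (p i)\<^sup>2)"
  define Q where "Q = (\<Sum>i<n. (q i)\<^sup>2)"
  have pos: "P > 0" "Q > 0"
    using p q unfolding P_def Q_def
    by (metis (no_types, lifting) finite_lessThan lessThan_iff sum_pos2 zero_le_power2 zero_less_power2)+
  obtain s t where st: "s * (\<Sum>i<n. p i) + t * (\<Sum>i<n. q i) = 0" "s \<noteq> 0 \<or> t \<noteq> 0"
  proof (cases "(\<Sum>i<n. q i) = 0")
    case True
    then show ?thesis using that[of 0 1] by simp
  next
    case False
    then show ?thesis using that[of "\<Sum>i<n. q i" "- (\<Sum>i<n. p i)"] by simp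
  qed
  define f where "f i = s * p i + t * q i" for i
  have comb: "(\<Sum>i<n. (a * p i + b * q i) * (a' * p i + b' * q i)) = a * a' * P + b * b' * Q"
    for a b a' b'
  proof -
    have "(\<Sum>i<n. (a * p i + b * q i) * (a' * p i + b' * q i))
      = (\<Sum>i<n. a * a' * (p i)\<^sup>2 + b * b' * (q i)\<^sup>2 + (a * b' + b * a') * (p i * q i))"
      by (intro sum.cong refl) (simp add: power2_eq_square algebra_simps)
    then show ?thesis
      by (simp add: sum.distrib P_def Q_def sum_distrib_left[symmetric] pq)
  qed
  have "(\<Sum>i<n. f i) = 0"
    using st(1) by (simp add: f_def sum.distrib sum_distrib_left)
  from ray[OF this] have "c * (\<Sum>i<n. (f i)\<^sup>2) \<le> dirichlet n E f" .
  also have "(\<Sum>i<n. (f i)\<^sup>2) = s * s * P + t * t * Q"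
    unfolding f_def power2_eq_square comb ..
  also have "dirichlet n E f = (\<Sum>i<n. f i * (\<Sum>j<n. ?L $$ (i,j) * f j))"
    using laplacian_form[OF G] by simp
  also have "\<dots> = (\<Sum>i<n. (s * p i + t * q i) * ((s * ?es ! 0) * p i + (t * ?es ! 1) * q i))"
  proof (intro sum.cong refl)
    fix i assume "i \<in> {..<n}"
    then have i: "i < n" by simp
    have "(\<Sum>j<n. ?L $$ (i,j) * f j)
        = s * (\<Sum>j<n. ?L $$ (i,j) * p j) + t * (\<Sum>j<n. ?L $$ (i,j) * q j)"
      by (simp add: f_def distrib_left sum.distrib sum_distrib_left mult_ac)
    then show "f i * (\<Sum>j<n. ?L $$ (i,j) * f j)
        = (s * p i + t * q i) * ((s * ?es ! 0) * p i + (t * ?es ! 1) * q i)"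
      using Lp[OF i] Lq[OF i] by (simp add: f_def mult_ac)
  qed
  also have "\<dots> = ?es ! 0 * (s * s * P) + ?es ! 1 * (t * t * Q)"
    unfolding comb by (simp add: mult_ac)
  also have "\<dots> \<le> ?es ! 1 * (s * s * P) + ?es ! 1 * (t * t * Q)"
  proof -
    have "?es ! 0 \<le> ?es ! 1"
      using laplacian_spectrum_char_poly[OF G] n by (intro sorted_nth_mono) auto
    then show ?thesis using pos by (intro add_right_mono mult_right_mono) auto
  qed
  also have "\<dots> = ?es ! 1 * (s * s * P + t * t * Q)" by (simp add: algebra_simps)
  finally have "c * (s * s * P + t * t * Q) \<le> ?es ! 1 * (s * s * P + t * t * Q)" .
  moreover have "s * s * P + t * t * Q > 0"
  proof -
    have "s * s * P \<ge> 0" "t * t * Q \<ge> 0" using pos by auto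
    moreover have "s * s * P \<noteq> 0 \<or> t * t * Q \<noteq> 0" using st(2) pos by auto
    ultimately show ?thesis by linarith
  qed
  ultimately show ?thesis by (simp add: alg_conn_def)
qed

lemma laplacian_eigenvalueI:
  assumes G: "simple_graph n E" and nz: "i < n" "f i \<noteq> 0"
    and ev: "\<And>i. i < n \<Longrightarrow> (\<Sum>j<n. if E i j then f i - f j else 0) = m * f i"
  shows "m \<in> set (laplacian_spectrum n E)"
proof -
  have "laplacian n E *\<^sub>v vec n f = m \<cdot>\<^sub>v vec n f"
  proof (intro eq_vecI)
    fix i assume "i < dim_vec (m \<cdot>\<^sub>v vec n f)"
    then have i: "i < n" by simp
    then have "vec_index (laplacian n E *\<^sub>v vec n f) i = (\<Sum>j<n. laplacian n E $$ (i,j) * f j)"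
      using laplacian_carrier[of n E] by (simp add: scalar_prod_def atLeast0LessThan)
    then show "vec_index (laplacian n E *\<^sub>v vec n f) i = vec_index (m \<cdot>\<^sub>v vec n f) i"
      using i ev[OF i] laplacian_row[OF G i, of f] by simp
  qed (use laplacian_carrier[of n E] in auto)
  moreover have "vec n f \<noteq> 0\<^sub>v n"
    using nz by (metis index_vec index_zero_vec(1))
  ultimately have "eigenvalue (laplacian n E) m"
    unfolding eigenvalue_def eigenvector_def using laplacian_carrier[of n E]
    by (intro exI[of _ "vec n f"]) auto
  then have "poly (\<Prod>e\<leftarrow>laplacian_spectrum n E. [:- e, 1:]) m = 0"
    using eigenvalue_root_char_poly[OF laplacian_carrier] laplacian_spectrum_char_poly(1)[OF G]
    by metis
  then show ?thesis by (auto simp: poly_prod_list prod_list_zero_iff)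
qed

lemma alg_conn_le_eigenvalue:
  assumes G: "simple_graph n E" and nz: "i < n" "f i \<noteq> 0" and m: "m > 0"
    and ev: "\<And>i. i < n \<Longrightarrow> (\<Sum>j<n. if E i j then f i - f j else 0) = m * f i"
  shows "alg_conn n E \<le> m"
proof -
  let ?es = "laplacian_spectrum n E"
  note spec = laplacian_spectrum_char_poly[OF G]
  have "m \<in> set ?es" by (rule laplacian_eigenvalueI[OF G nz ev])
  then obtain j where j: "j < length ?es" "?es ! j = m" by (auto simp: in_set_conv_nth)
  have "0 \<in> set ?es"
    by (rule laplacian_eigenvalueI[OF G nz(1), of "\<lambda>_. 1"]) auto
  then obtain k where k: "k < length ?es" "?es ! k = 0" by (auto simp: in_set_conv_nth)
  have "j \<noteq> 0"
    using sorted_nth_mono[OF spec(3), of 0 k] j k m by (metis le0 not_le)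
  then have "?es ! 1 \<le> ?es ! j"
    using j by (intro sorted_nth_mono[OF spec(3)]) auto
  then show ?thesis using j by (simp add: alg_conn_def)
qed

section \<open>Degree bounds\<close>

lemma recip_sqrt_ge:
  fixes x y r :: real
  assumes "x > 0" "y > 0" "r > 0" "x \<le> r * y" "y \<le> r * x"
  shows "sqrt r / (1 + r) * (1 / x + 1 / y) \<le> 1 / sqrt (x * y)"
proof -
  have "0 \<le> (r * x - y) * (r * y - x)" using assms by simp
  then have "r * (x + y)\<^sup>2 \<le> (1 + r)\<^sup>2 * (x * y)"
    by (simp add: power2_eq_square algebra_simps)
  then have "sqrt (r * (x + y)\<^sup>2) \<le> sqrt ((1 + r)\<^sup>2 * (x * y))" by simp
  then have *: "sqrt r * (x + y) \<le> (1 + r) * sqrt (x * y)"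
    using assms by (simp add: real_sqrt_mult)
  have "sqrt r / (1 + r) * (1 / x + 1 / y) = sqrt r * (x + y) / ((1 + r) * (x * y))"
    using assms by (simp add: field_simps)
  also have "\<dots> \<le> (1 + r) * sqrt (x * y) / ((1 + r) * (x * y))"
    using * assms by (intro divide_right_mono) auto
  also have "\<dots> = sqrt (x * y) / (x * y)" using assms by simp
  also have "\<dots> = 1 / sqrt (x * y)"
    using assms by (simp add: sqrt_divide_self_eq inverse_eq_divide)
  finally show ?thesis .
qed

text \<open>Each edge weight dominates a multiple of \<open>1/d(u) + 1/d(v)\<close>, and these
  sum to \<open>n\<close> over all edges.\<close>
lemma randic_ge_ratio:
  assumes G: "simple_graph n E" and r: "r > 0"
    and pos: "\<And>u. u < n \<Longrightarrow> deg n E u > 0"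
    and ratio: "\<And>u v. u < n \<Longrightarrow> v < n \<Longrightarrow> real (deg n E u) \<le> r * real (deg n E v)"
  shows "real n * (sqrt r / (1 + r)) \<le> randic n E"
proof -
  let ?d = "\<lambda>u. real (deg n E u)"
  have "real n * (sqrt r / (1 + r)) = sqrt r / (1 + r) * (\<Sum>u<n. ?d u * (1 / ?d u))"
  proof -
    have "(\<Sum>u<n. ?d u * (1 / ?d u)) = (\<Sum>u<n. 1)"
      using pos by (intro sum.cong refl) auto
    then show ?thesis by simp
  qed
  also have "\<dots> = sqrt r / (1 + r) * edge_sum n E (\<lambda>u v. 1 / ?d u + 1 / ?d v)"
    using edge_sum_endpoints[OF G, of "\<lambda>u. 1 / ?d u"] by simp
  also have "\<dots> \<le> randic n E"
    unfolding randic_eq_edge_sum edge_sum_scale[symmetric]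
    using r pos ratio by (intro edge_sum_mono recip_sqrt_ge) auto
  finally show ?thesis .
qed

lemma deg_le:
  assumes "simple_graph n E" "u < n"
  shows "deg n E u \<le> n - 1"
proof -
  have "deg n E u \<le> card ({..<n} - {u})"
    unfolding deg_def by (rule card_mono) (auto simp: simple_graphD(4)[OF assms(1)])
  then show ?thesis using assms by simp
qed

lemma randic_ge_sqrt:
  assumes G: "simple_graph n E" and n: "n \<ge> 2"
    and pos: "\<And>u. u < n \<Longrightarrow> deg n E u > 0"
  shows "sqrt (real n - 1) \<le> randic n E"
proof -
  have "real (deg n E u) \<le> (real n - 1) * real (deg n E v)" if "u < n" "v < n" for u v
  proof -
    have "real (deg n E u) \<le> (real n - 1) * 1"
      using deg_le[OF G that(1)] n by (simp add: of_nat_diff)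
    also have "\<dots> \<le> (real n - 1) * real (deg n E v)"
      using pos[OF that(2)] n by (intro mult_left_mono) auto
    finally show ?thesis .
  qed
  from randic_ge_ratio[OF G _ pos this] show ?thesis using n by simp
qed

lemma randic_ge_min_degree:
  assumes G: "simple_graph n E" and n: "n \<ge> 2"
    and pos: "\<And>u. u < n \<Longrightarrow> deg n E u > 0"
    and \<delta>: "\<And>u. u < n \<Longrightarrow> \<delta> \<le> real (deg n E u)"
  shows "real n * \<delta> / (2 * (real n - 1)) \<le> randic n E"
proof -
  let ?h = "1 / (2 * (real n - 1))"
  have "real n * \<delta> / (2 * (real n - 1)) = (\<Sum>u<n. \<delta> * ?h)" by simp
  also have "\<dots> \<le> (\<Sum>u<n. real (deg n E u) * ?h)"
    using \<delta> n by (intro sum_mono mult_right_mono) auto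
  also have "\<dots> = edge_sum n E (\<lambda>u v. ?h + ?h)"
    using edge_sum_endpoints[OF G, of "\<lambda>_. ?h"] by simp
  also have "\<dots> \<le> randic n E"
    unfolding randic_eq_edge_sum
  proof (rule edge_sum_mono)
    fix u v assume uv: "u < v" "v < n" "E u v"
    then have "real (deg n E u) \<le> real n - 1" "real (deg n E v) \<le> real n - 1"
      using deg_le[OF G, of u] deg_le[OF G, of v] by linarith+
    then have "real (deg n E u) * real (deg n E v) \<le> (real n - 1) * (real n - 1)"
      using n by (intro mult_mono) auto
    then have "sqrt (real (deg n E u) * real (deg n E v)) \<le> sqrt ((real n - 1) * (real n - 1))"
      by (rule real_sqrt_le_mono)
    also have "\<dots> = real n - 1" using n by (intro real_sqrt_unique) (auto simp: power2_eq_square)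
    finally have "1 / (real n - 1) \<le> 1 / sqrt (real (deg n E u) * real (deg n E v))"
      using pos[of u] pos[of v] uv by (intro divide_left_mono) auto
    moreover have "?h + ?h = 1 / (real n - 1)" using n by (simp add: field_simps)
    ultimately show "?h + ?h \<le> 1 / sqrt (real (deg n E u) * real (deg n E v))"
      by simp
  qed
  finally show ?thesis .
qed

lemma edge_sum_nonneg: "(\<And>u v. w u v \<ge> 0) \<Longrightarrow> edge_sum n E w \<ge> 0"
  unfolding edge_sum_def by (rule sum_nonneg) auto

text \<open>On vectors orthogonal to the constants the Dirichlet forms of a graph and of its
  complement add up to \<open>n\<close> times the squared norm, and the form of the complement is at most
  twice its maximum degree.\<close>
lemma alg_conn_ge_min_degree:
  assumes G: "simple_graph n E" and n: "n \<ge> 2"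
    and \<delta>: "\<And>u. u < n \<Longrightarrow> \<delta> \<le> real (deg n E u)"
  shows "2 * \<delta> - real n + 2 \<le> alg_conn n E"
proof (rule alg_conn_ge[OF G n])
  fix f :: "nat \<Rightarrow> real" assume f0: "(\<Sum>i<n. f i) = 0"
  define N where "N = (\<Sum>i<n. (f i)\<^sup>2)"
  let ?c = "\<lambda>i j. if E i j \<or> i = j then 0 else (1::real)"
  have codeg: "(\<Sum>j<n. ?c i j) = real n - 1 - real (deg n E i)" if "i < n" for i
  proof -
    have "(\<Sum>j<n. ?c i j) = (\<Sum>j<n. 1 - (if j = i then 1 else 0) - (if E i j then 1 else 0))"
      using simple_graphD(4)[OF G] by (intro sum.cong) auto
    then show ?thesis using that by (simp add: sum_subtractf deg_eq_sum)
  qed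
  let ?T = "\<Sum>i<n. \<Sum>j<n. ?c i j * (f i)\<^sup>2"
  have "?T = (\<Sum>i<n. (real n - 1 - real (deg n E i)) * (f i)\<^sup>2)"
    unfolding sum_distrib_right[symmetric] by (intro sum.cong refl) (simp add: codeg)
  also have "\<dots> \<le> (\<Sum>i<n. (real n - 1 - \<delta>) * (f i)\<^sup>2)"
    using \<delta> by (intro sum_mono mult_right_mono) auto
  finally have T: "?T \<le> (real n - 1 - \<delta>) * N" by (simp add: N_def sum_distrib_left)
  have swap: "(\<Sum>i<n. \<Sum>j<n. ?c i j * (f j)\<^sup>2) = ?T"
    by (subst sum.swap) (intro sum.cong refl, simp add: simple_graphD(5)[OF G] eq_commute)
  have "(\<Sum>i<n. \<Sum>j<n. (f i - f j)\<^sup>2)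
      = (\<Sum>i<n. real n * (f i)\<^sup>2 + N - 2 * f i * (\<Sum>j<n. f j))"
    by (intro sum.cong refl) (simp add: power2_diff sum.distrib sum_subtractf N_def sum_distrib_left)
  also have "\<dots> = 2 * real n * N"
    by (simp add: f0 sum.distrib N_def sum_distrib_left[symmetric])
  finally have "2 * real n * N = (\<Sum>i<n. \<Sum>j<n. (f i - f j)\<^sup>2)" by simp
  also have "\<dots> \<le> (\<Sum>i<n. \<Sum>j<n. (if E i j then (f i - f j)\<^sup>2 else 0)
      + 2 * (?c i j * (f i)\<^sup>2 + ?c i j * (f j)\<^sup>2))"
  proof (intro sum_mono)
    fix i j
    have "0 \<le> (f i + f j)\<^sup>2" by simp
    then show "(f i - f j)\<^sup>2 \<le> (if E i j then (f i - f j)\<^sup>2 else 0)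
      + 2 * (?c i j * (f i)\<^sup>2 + ?c i j * (f j)\<^sup>2)"
      by (auto simp: power2_sum power2_diff power2_eq_square[of "f j"])
  qed
  also have "\<dots> = (\<Sum>i<n. \<Sum>j<n. if E i j then (f i - f j)\<^sup>2 else 0) + 2 * (?T + ?T)"
    unfolding sum.distrib sum_distrib_left[symmetric] swap by simp
  also have "(\<Sum>i<n. \<Sum>j<n. if E i j then (f i - f j)\<^sup>2 else 0) = 2 * dirichlet n E f"
    by (rule edge_sum_double[OF G, symmetric]) (simp add: power2_commute)
  finally have "real n * N \<le> dirichlet n E f + 2 * ((real n - 1 - \<delta>) * N)" using T by simp
  then show "(2 * \<delta> - real n + 2) * (\<Sum>i<n. (f i)\<^sup>2) \<le> dirichlet n E f"
    unfolding N_def[symmetric] by (simp add: algebra_simps)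
qed

text \<open>Shifting a vector orthogonal to the constants so that its extreme values become opposite
  does not decrease its norm.\<close>
lemma alg_conn_ge_range:
  assumes G: "simple_graph n E" and n: "n \<ge> 2" and c: "c \<ge> 0"
    and ray: "\<And>g u v. u < n \<Longrightarrow> v < n \<Longrightarrow> g u = 1 \<Longrightarrow> g v = -1 \<Longrightarrow> (\<And>i. i < n \<Longrightarrow> (g i)\<^sup>2 \<le> 1)
      \<Longrightarrow> c * (\<Sum>i<n. (g i)\<^sup>2) \<le> dirichlet n E g"
  shows "c \<le> alg_conn n E"
proof (rule alg_conn_ge[OF G n])
  fix f :: "nat \<Rightarrow> real" assume f0: "(\<Sum>i<n. f i) = 0"
  have fin: "finite (f ` {..<n})" "f ` {..<n} \<noteq> {}" using n by (auto simp: lessThan_empty_iff)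
  obtain u where u: "u < n" "\<And>i. i < n \<Longrightarrow> f i \<le> f u"
    using Max_in[OF fin] Max_ge[OF fin(1)] by fastforce
  obtain v where v: "v < n" "\<And>i. i < n \<Longrightarrow> f v \<le> f i"
    using Min_in[OF fin] Min_le[OF fin(1)] by fastforce
  define h where "h = (f u - f v) / 2"
  define m where "m = (f u + f v) / 2"
  show "c * (\<Sum>i<n. (f i)\<^sup>2) \<le> dirichlet n E f"
  proof (cases "h = 0")
    case True
    then have "f i = f u" if "i < n" for i using u(2)[OF that] v(2)[OF that] by (simp add: h_def)
    then have const: "\<And>i. i < n \<Longrightarrow> f i = f u" by blast
    then have "real n * f u = 0" using f0 by simp
    then have "(\<Sum>i<n. (f i)\<^sup>2) = 0" using const n by simp
    then show ?thesis by (simp add: edge_sum_nonneg)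
  next
    case False
    then have h: "h > 0" using u(2)[OF v(1)] by (simp add: h_def)
    define g where "g i = (f i - m) / h" for i
    have gu: "g u = 1" and gv: "g v = -1"
      using h by (auto simp: g_def m_def h_def field_simps)
    have "(g i)\<^sup>2 \<le> 1" if "i < n" for i
    proof -
      have "\<bar>f i - m\<bar> \<le> h" using u(2)[OF that] v(2)[OF that] by (simp add: m_def h_def abs_le_iff field_simps)
      then have "\<bar>g i\<bar> \<le> 1" using h by (simp add: g_def)
      then show ?thesis by (simp add: abs_square_le_1)
    qed
    from ray[OF u(1) v(1) gu gv this] have "c * (\<Sum>i<n. (g i)\<^sup>2) \<le> dirichlet n E g" .
    then have 1: "h\<^sup>2 * (c * (\<Sum>i<n. (g i)\<^sup>2)) \<le> h\<^sup>2 * dirichlet n E g"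
      by (intro mult_left_mono) auto
    have "h\<^sup>2 * (\<Sum>i<n. (g i)\<^sup>2) = (\<Sum>i<n. (f i - m)\<^sup>2)"
      using h by (simp add: sum_distrib_left g_def power_divide)
    also have "\<dots> = (\<Sum>i<n. (f i)\<^sup>2 + m\<^sup>2 - 2 * m * f i)"
      by (intro sum.cong refl) (simp add: power2_diff)
    also have "\<dots> = (\<Sum>i<n. (f i)\<^sup>2) + real n * m\<^sup>2"
      by (simp add: sum.distrib sum_subtractf sum_distrib_left[symmetric] f0)
    finally have "(\<Sum>i<n. (f i)\<^sup>2) \<le> h\<^sup>2 * (\<Sum>i<n. (g i)\<^sup>2)" by simp
    then have 2: "c * (\<Sum>i<n. (f i)\<^sup>2) \<le> c * (h\<^sup>2 * (\<Sum>i<n. (g i)\<^sup>2))"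
      using c by (rule mult_left_mono)
    have "h\<^sup>2 * dirichlet n E g = edge_sum n E (\<lambda>u v. h\<^sup>2 * (g u - g v)\<^sup>2)"
      by (simp add: edge_sum_scale)
    also have "(\<lambda>u v. h\<^sup>2 * (g u - g v)\<^sup>2) = (\<lambda>u v. (f u - f v)\<^sup>2)"
      using h by (intro ext) (simp add: g_def power_divide diff_divide_distrib[symmetric])
    finally show ?thesis using 1 2 by (simp add: mult_ac)
  qed
qed

lemma sum_squares_le:
  fixes g :: "nat \<Rightarrow> real"
  assumes S: "S \<subseteq> {..<n}" and g: "\<And>i. i < n \<Longrightarrow> (g i)\<^sup>2 \<le> 1"
  shows "(\<Sum>i<n. (g i)\<^sup>2) \<le> (\<Sum>i\<in>S. (g i)\<^sup>2) + (real n - real (card S))"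
proof -
  have "(\<Sum>i<n. (g i)\<^sup>2) = (\<Sum>i\<in>S. (g i)\<^sup>2) + (\<Sum>i\<in>{..<n} - S. (g i)\<^sup>2)"
    using S by (metis add.commute finite_lessThan sum.subset_diff)
  also have "(\<Sum>i\<in>{..<n} - S. (g i)\<^sup>2) \<le> real (card ({..<n} - S)) * 1"
    using g by (intro sum_bounded_above) auto
  also have "real (card ({..<n} - S)) = real n - real (card S)"
    using S by (simp add: card_Diff_subset finite_subset[OF S] of_nat_diff subset_eq_atLeast0_lessThan_card card_mono[OF _ S, simplified])
  finally show ?thesis by simp
qed

lemma dirichlet_ge_arcs:
  assumes G: "simple_graph n E"
    and F: "\<And>u v. (u,v) \<in> F \<Longrightarrow> E u v" "\<And>u v. (u,v) \<in> F \<Longrightarrow> (v,u) \<notin> F"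
  shows "(\<Sum>(u,v)\<in>F. (f u - f v)\<^sup>2) \<le> dirichlet n E f"
  by (rule edge_sum_ge_arcs[OF G _ _ F]) (auto simp: power2_commute)

section \<open>Distances\<close>

lemma walk_successively:
  "walk n E xs \<longleftrightarrow> xs \<noteq> [] \<and> set xs \<subseteq> {..<n} \<and> successively E xs"
  by (auto simp: walk_def successively_conv_nth)

lemma successively_leaves:
  assumes "successively E xs" "xs \<noteq> []" "hd xs \<in> S" "last xs \<notin> S"
  shows "\<exists>p q. p \<in> S \<and> q \<notin> S \<and> E p q"
  using assms
proof (induction xs)
  case (Cons x xs)
  then show ?case by (cases xs) (auto split: if_splits)
qed simp

lemma connected_crossing_edge:
  assumes "connected_graph n E" "u < n" "v < n" "u \<in> S" "v \<notin> S"
  obtains p q where "p \<in> S" "q \<notin> S" "E p q"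
proof -
  obtain xs where "walk n E xs" "hd xs = u" "last xs = v"
    using assms unfolding connected_graph_def by blast
  then show ?thesis
    using successively_leaves[of E xs S] assms that by (auto simp: walk_successively)
qed

lemma connected_deg_pos:
  assumes G: "simple_graph n E" and c: "connected_graph n E" and n: "2 \<le> n" and u: "u < n"
  shows "deg n E u > 0"
proof -
  have "\<exists>v<n. v \<noteq> u" using n by (intro exI[of _ "if u = 0 then 1 else 0"]) auto
  then obtain v where "v < n" "v \<noteq> u" by blast
  then obtain q where "E u q" using connected_crossing_edge[OF c u, of v "{u}"] by auto
  then have "q \<in> {v. v < n \<and> E u v}" using simple_graphD(2)[OF G] by auto
  then show ?thesis unfolding deg_def by (subst card_gt_0_iff) auto
qed

lemma min_degree_le: "u < n \<Longrightarrow> min_degree n E \<le> deg n E u"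
  unfolding min_degree_def by (rule Min_le) auto

lemma gdist_le_diameter:
  assumes "u < n" "v < n"
  shows "gdist n E u v \<le> diameter n E"
proof -
  have "{gdist n E u v |u v. u < n \<and> v < n} = (\<lambda>(u,v). gdist n E u v) ` ({..<n} \<times> {..<n})"
    by auto
  then have "finite {gdist n E u v |u v. u < n \<and> v < n}" by simp
  then show ?thesis unfolding diameter_def using assms by (intro Max_ge) auto
qed

lemma geodesic_exists:
  assumes c: "connected_graph n E" and uv: "u < n" "v < n"
  obtains xs where "walk n E xs" "hd xs = u" "last xs = v" "length xs = Suc (gdist n E u v)"
    "distinct xs"
proof -
  let ?P = "\<lambda>k. \<exists>xs. walk n E xs \<and> hd xs = u \<and> last xs = v \<and> length xs = Suc k"
  obtain ys where "walk n E ys" "hd ys = u" "last ys = v"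
    using assms unfolding connected_graph_def by blast
  then have "?P (length ys - 1)"
    by (intro exI[of _ ys]) (auto simp: walk_def)
  then have "?P (gdist n E u v)" unfolding gdist_def by (rule LeastI)
  then obtain xs where xs: "walk n E xs" "hd xs = u" "last xs = v" "length xs = Suc (gdist n E u v)"
    by blast
  have "distinct xs"
  proof (rule ccontr)
    assume "\<not> distinct xs"
    then obtain as bs cs y where d: "xs = as @ [y] @ bs @ [y] @ cs"
      using not_distinct_decomp by blast
    let ?zs = "as @ [y] @ cs"
    have "walk n E ?zs" using xs(1) unfolding d walk_successively
      by (auto simp: successively_append_iff successively_Cons)
    moreover have "hd ?zs = u" using xs(2) unfolding d by (cases as) auto
    moreover have "last ?zs = v" using xs(3) unfolding d by (cases cs) auto
    moreover have "length ?zs = Suc (length as + length cs)" by simp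
    ultimately have "?P (length as + length cs)" by blast
    then have "gdist n E u v \<le> length as + length cs" unfolding gdist_def by (rule Least_le)
    then show False using xs(4) unfolding d by simp
  qed
  with xs show ?thesis by (rule that)
qed

lemma diff_square_le_diameter:
  assumes G: "simple_graph n E" and c: "connected_graph n E" and uv: "u < n" "v < n"
  shows "(f u - f v)\<^sup>2 \<le> real (diameter n E) * dirichlet n E f"
proof -
  obtain xs where xs: "walk n E xs" "hd xs = u" "last xs = v" "distinct xs"
    and len: "length xs = Suc (gdist n E u v)"
    using geodesic_exists[OF c uv] by metis
  define k where "k = gdist n E u v"
  let ?h = "\<lambda>i. (xs ! i, xs ! Suc i)"
  let ?F = "?h ` {..<k}"
  have nth: "xs ! i = xs ! j \<longleftrightarrow> i = j" if "i \<le> k" "j \<le> k" for i j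
    using that xs(4) len by (simp add: nth_eq_iff_index_eq k_def)
  have inj: "inj_on ?h {..<k}" by (auto simp: inj_on_def nth)
  have arcs: "(\<Sum>(u,v)\<in>?F. (f u - f v)\<^sup>2) \<le> dirichlet n E f"
  proof (rule dirichlet_ge_arcs[OF G])
    show "\<And>u v. (u,v) \<in> ?F \<Longrightarrow> E u v"
      using xs(1) len by (auto simp: walk_def k_def)
    show "(v,u) \<notin> ?F" if "(u,v) \<in> ?F" for u v
      using that nth by (auto simp: nth Suc_le_eq)
  qed
  have "f u - f v = (\<Sum>i<k. f (xs ! i) - f (xs ! Suc i))"
  proof -
    have "xs \<noteq> []" using len by auto
    then have "u = xs ! 0" "v = xs ! k"
      using xs(2,3) len by (auto simp: hd_conv_nth last_conv_nth k_def)
    then show ?thesis using sum_lessThan_telescope'[of "\<lambda>i. f (xs ! i)" k] by simp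
  qed
  then have "(f u - f v)\<^sup>2 \<le> (\<Sum>i<k. (f (xs ! i) - f (xs ! Suc i))\<^sup>2) * real k"
    using sum_squared_le_sum_of_squares[of "\<lambda>i. f (xs ! i) - f (xs ! Suc i)" "{..<k}"] by simp
  also have "(\<Sum>i<k. (f (xs ! i) - f (xs ! Suc i))\<^sup>2) = (\<Sum>(u,v)\<in>?F. (f u - f v)\<^sup>2)"
    by (subst sum.reindex[OF inj]) simp
  also have "\<dots> * real k \<le> dirichlet n E f * real (diameter n E)"
    using arcs gdist_le_diameter[OF uv, of E]
    by (intro mult_mono) (auto simp: k_def edge_sum_nonneg)
  finally show ?thesis by (simp add: mult.commute)
qed

lemma alg_conn_ge_diameter:
  assumes G: "simple_graph n E" and c: "connected_graph n E" and n: "n \<ge> 2"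
    and D: "diameter n E > 0"
  shows "4 / (real n * real (diameter n E)) \<le> alg_conn n E"
proof (rule alg_conn_ge_range[OF G n])
  fix g :: "nat \<Rightarrow> real" and u v
  assume g: "u < n" "v < n" "g u = 1" "g v = -1" "\<And>i. i < n \<Longrightarrow> (g i)\<^sup>2 \<le> 1"
  have "(\<Sum>i<n. (g i)\<^sup>2) \<le> real n" using sum_squares_le[of "{}" n g] g(5) by simp
  then have "4 / (real n * real (diameter n E)) * (\<Sum>i<n. (g i)\<^sup>2)
      \<le> 4 / (real n * real (diameter n E)) * real n"
    by (intro mult_left_mono) auto
  also have "\<dots> = 4 / real (diameter n E)" using n by simp
  also have "\<dots> \<le> dirichlet n E g"
    using diff_square_le_diameter[OF G c g(1,2), of g] D g(3,4) by (simp add: field_simps)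
  finally show "4 / (real n * real (diameter n E)) * (\<Sum>i<n. (g i)\<^sup>2) \<le> dirichlet n E g" .
qed simp

lemma diameter_1_deg:
  assumes G: "simple_graph n E" and c: "connected_graph n E" and D: "diameter n E \<le> 1"
    and u: "u < n"
  shows "deg n E u = n - 1"
proof -
  have "E u v" if v: "v < n" "v \<noteq> u" for v
  proof -
    obtain xs where xs: "walk n E xs" "hd xs = u" "last xs = v" "length xs = Suc (gdist n E u v)"
      using geodesic_exists[OF c u v(1)] by metis
    have "length xs \<le> 2" using xs(4) gdist_le_diameter[OF u v(1), of E] D by simp
    then show ?thesis using xs(1-3) v
      by (cases xs; cases "tl xs") (auto simp: walk_successively)
  qed
  then have "{v. v < n \<and> E u v} = {..<n} - {u}" using simple_graphD(4)[OF G] by auto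
  then show ?thesis unfolding deg_def using u by simp
qed

lemma alg_conn_ge_distance_2:
  assumes G: "simple_graph n E" and n: "n \<ge> 3"
    and dist: "\<And>u v. u < n \<Longrightarrow> v < n \<Longrightarrow> u \<noteq> v \<Longrightarrow> E u v \<or> (\<exists>w. E u w \<and> E w v)"
  shows "2 / (real n - 1) \<le> alg_conn n E"
proof (rule alg_conn_ge_range[OF G])
  fix g :: "nat \<Rightarrow> real" and u v
  assume g: "u < n" "v < n" "g u = 1" "g v = -1" "\<And>i. i < n \<Longrightarrow> (g i)\<^sup>2 \<le> 1"
  let ?c = "2 / (real n - 1)" and ?N = "\<Sum>i<n. (g i)\<^sup>2"
  have c: "0 \<le> ?c" "?c \<le> 1" using n by auto
  have uv: "u \<noteq> v" using g by auto
  show "?c * ?N \<le> dirichlet n E g"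
  proof (cases "E u v")
    case True
    have "?N \<le> real n" using sum_squares_le[of "{}" n g] g(5) by simp
    then have "?c * ?N \<le> ?c * real n" using c(1) by (rule mult_left_mono)
    also have "\<dots> \<le> 4" using n by (simp add: field_simps)
    also have "\<dots> = (\<Sum>(x,y)\<in>{(u,v)}. (g x - g y)\<^sup>2)" using g by simp
    also have "\<dots> \<le> dirichlet n E g"
      using True uv by (intro dirichlet_ge_arcs[OF G]) auto
    finally show ?thesis .
  next
    case False
    then obtain w where w: "E u w" "E w v" using dist[OF g(1,2) uv] by blast
    then have ne: "u \<noteq> w" "w \<noteq> v" and wn: "w < n" using simple_graphD[OF G] by metis+
    have "?N \<le> real n - 1 + (g w)\<^sup>2"
      using sum_squares_le[of "{w}" n g] g(5) wn by simp
    then have "?c * ?N \<le> ?c * (real n - 1) + ?c * (g w)\<^sup>2"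
      using c(1) by (metis distrib_left mult_left_mono)
    also have "?c * (real n - 1) = 2" using n by (subst nonzero_eq_divide_eq[symmetric]) auto
    also have "2 + ?c * (g w)\<^sup>2 \<le> 2 + 1 * (g w)\<^sup>2"
      using c(2) by (intro add_left_mono mult_right_mono) auto
    also have "\<dots> \<le> (1 - g w)\<^sup>2 + (g w + 1)\<^sup>2"
      by (simp add: power2_eq_square algebra_simps)
    also have "\<dots> = (\<Sum>(x,y)\<in>{(u,w),(w,v)}. (g x - g y)\<^sup>2)" using g ne by simp
    also have "\<dots> \<le> dirichlet n E g"
      using w ne uv by (intro dirichlet_ge_arcs[OF G]) auto
    finally show ?thesis .
  qed
qed (use n in auto)

text \<open>The value \<open>4 / (3 n - 5)\<close> is the \<open>c\<close> for which
  \<open>(1 - x)\<^sup>2 + (x - y)\<^sup>2 + (1 + y)\<^sup>2 - c (n - 2 + x\<^sup>2 + y\<^sup>2)\<close> is still nonnegative: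
  at \<open>y = -x\<close> its discriminant in \<open>x\<close> is a negative multiple of \<open>c (1 - c)\<close>.\<close>
lemma alg_conn_ge_distance_3:
  assumes G: "simple_graph n E" and n: "n \<ge> 3"
    and dist: "\<And>u v. u < n \<Longrightarrow> v < n \<Longrightarrow> u \<noteq> v \<Longrightarrow>
      E u v \<or> (\<exists>w. E u w \<and> E w v) \<or> (\<exists>p q. E u p \<and> E p q \<and> E q v)"
  shows "4 / (3 * real n - 5) \<le> alg_conn n E"
proof (rule alg_conn_ge_range[OF G])
  fix g :: "nat \<Rightarrow> real" and u v
  assume g: "u < n" "v < n" "g u = 1" "g v = -1" "\<And>i. i < n \<Longrightarrow> (g i)\<^sup>2 \<le> 1"
  define c where "c = 4 / (3 * real n - 5)"
  let ?N = "\<Sum>i<n. (g i)\<^sup>2"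
  have c: "0 \<le> c" "c \<le> 1" and cn: "c * (real n - 2) = (4 - c) / 3"
    using n by (auto simp: c_def field_simps)
  have uv: "u \<noteq> v" using g by auto
  have N: "?N \<le> real n" using sum_squares_le[of "{}" n g] g(5) by simp
  consider "E u v" | w where "\<not> E u v" "E u w" "E w v"
    | p q where "\<not> E u v" "E u p" "E p q" "E q v"
    using dist[OF g(1,2) uv] by blast
  then have "c * ?N \<le> dirichlet n E g"
  proof cases
    case 1
    have "c * ?N \<le> c * real n" using N c(1) by (rule mult_left_mono)
    also have "\<dots> \<le> 4" using n by (simp add: field_simps c_def)
    also have "\<dots> = (\<Sum>(x,y)\<in>{(u,v)}. (g x - g y)\<^sup>2)" using g by simp
    also have "\<dots> \<le> dirichlet n E g"
      using 1 uv by (intro dirichlet_ge_arcs[OF G]) auto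
    finally show ?thesis .
  next
    case 2
    then have ne: "u \<noteq> w" "w \<noteq> v" and wn: "w < n" using simple_graphD[OF G] by metis+
    have "?N \<le> real n - 1 + (g w)\<^sup>2"
      using sum_squares_le[of "{w}" n g] g(5) wn by simp
    then have "c * ?N \<le> c * (real n - 1) + c * (g w)\<^sup>2"
      using c(1) by (metis distrib_left mult_left_mono)
    also have "\<dots> \<le> 2 + 1 * (g w)\<^sup>2"
      using c(2) n by (intro add_mono mult_right_mono) (auto simp: c_def field_simps)
    also have "\<dots> \<le> (1 - g w)\<^sup>2 + (g w + 1)\<^sup>2"
      by (simp add: power2_eq_square algebra_simps)
    also have "\<dots> = (\<Sum>(x,y)\<in>{(u,w),(w,v)}. (g x - g y)\<^sup>2)" using g ne by simp
    also have "\<dots> \<le> dirichlet n E g"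
      using 2 ne uv by (intro dirichlet_ge_arcs[OF G]) auto
    finally show ?thesis .
  next
    case 3
    then have ne: "u \<noteq> p" "q \<noteq> v" "p \<noteq> q" "u \<noteq> q" "p \<noteq> v" and pn: "p < n" and qn: "q < n"
      using simple_graphD[OF G] by metis+
    define x y where "x = g p" and "y = g q"
    have "?N \<le> real n - 2 + (x\<^sup>2 + y\<^sup>2)"
      using sum_squares_le[of "{p,q}" n g] g(5) pn qn ne(3) by (simp add: x_def y_def)
    then have "c * ?N \<le> c * (real n - 2) + c * (x\<^sup>2 + y\<^sup>2)"
      using c(1) by (metis distrib_left mult_left_mono)
    also have "\<dots> = (4 - c) / 3 + c * (x\<^sup>2 + y\<^sup>2)" by (simp only: cn)
    also have "\<dots> \<le> (1 - x)\<^sup>2 + (x - y)\<^sup>2 + (y + 1)\<^sup>2"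
    proof -
      define d s where "d = x - y" and "s = x + y"
      have "0 \<le> ((3 - c) * d - 2)\<^sup>2 / (3 - c) + (1 - c) * s\<^sup>2"
        using c by simp
      moreover have "((3 - c) * d - 2)\<^sup>2 / (3 - c) = (3 - c) * d\<^sup>2 - 4 * d + 4 / (3 - c)"
        using c by (simp add: power2_diff field_simps power2_eq_square)
      moreover have "4 / (3 - c) \<le> (4 + 2 * c) / 3"
      proof -
        have "0 \<le> c * (1 - c)" using c by simp
        then have "4 * 3 \<le> (4 + 2 * c) * (3 - c)" by (simp add: algebra_simps power2_eq_square)
        then show ?thesis using c by (simp add: field_simps)
      qed
      ultimately have "0 \<le> (3 - c) * d\<^sup>2 - 4 * d + (4 + 2 * c) / 3 + (1 - c) * s\<^sup>2" by linarith
      also have "\<dots> = 2 * ((1 - x)\<^sup>2 + (x - y)\<^sup>2 + (y + 1)\<^sup>2 - ((4 - c) / 3 + c * (x\<^sup>2 + y\<^sup>2)))"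
        by (simp add: d_def s_def power2_eq_square field_simps)
      finally show ?thesis by (simp only: zero_le_mult_iff) simp
    qed
    also have "\<dots> = (\<Sum>(x,y)\<in>{(u,p),(p,q),(q,v)}. (g x - g y)\<^sup>2)"
      using g ne by (simp add: x_def y_def)
    also have "\<dots> \<le> dirichlet n E g"
      using 3 ne uv by (intro dirichlet_ge_arcs[OF G]) auto
    finally show ?thesis .
  qed
  then show "4 / (3 * real n - 5) * ?N \<le> dirichlet n E g" by (simp add: c_def)
qed (use n in auto)

section \<open>The path\<close>

lemma simple_path_graph: "simple_graph n (path_graph n)"
  by (auto simp: simple_graph_def path_graph_def)

lemma edge_sum_path_graph:
  "edge_sum n (path_graph n) w = (\<Sum>i<n-1. w i (Suc i))"
proof -
  have "{(u,v). u < v \<and> v < n \<and> path_graph n u v} = (\<lambda>i. (i, Suc i)) ` {..<n-1}"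
    by (auto simp: path_graph_def image_iff)
  then show ?thesis unfolding edge_sum_def
    by (simp add: sum.reindex inj_on_def)
qed

lemma deg_path_graph:
  assumes "i < n" "n \<ge> 2"
  shows "deg n (path_graph n) i = (if i = 0 \<or> Suc i = n then 1 else 2)"
proof -
  have "{v. v < n \<and> path_graph n i v}
      = (if i = 0 then {1} else if Suc i = n then {i - 1} else {i - 1, Suc i})"
    using assms by (auto simp: path_graph_def)
  moreover have "i - 1 \<noteq> Suc i" by simp
  ultimately show ?thesis by (simp add: deg_def)
qed

lemma randic_path_graph:
  assumes "n \<ge> 3"
  shows "randic n (path_graph n) = (real n - 3 + 2 * sqrt 2) / 2"
proof -
  obtain m where m: "n = m + 3" using assms by (metis add.commute le_Suc_ex)
  let ?d = "\<lambda>i. real (deg n (path_graph n) i)"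
  let ?w = "\<lambda>i. 1 / sqrt (?d i * ?d (Suc i))"
  have "randic n (path_graph n) = (\<Sum>i<Suc (Suc m). ?w i)"
    by (simp add: randic_eq_edge_sum edge_sum_path_graph m del: sum.lessThan_Suc)
  also have "\<dots> = ?w 0 + (\<Sum>i<m. ?w (Suc i)) + ?w (Suc m)"
    unfolding sum.lessThan_Suc_shift[of _ "Suc m"] by simp
  also have "(\<Sum>i<m. ?w (Suc i)) = (\<Sum>i<m. 1 / 2)"
    by (intro sum.cong refl) (auto simp: deg_path_graph m)
  also have "?w 0 + (\<Sum>i<m. 1 / 2) + ?w (Suc m) = 2 / sqrt 2 + real m / 2"
    by (simp add: deg_path_graph m)
  also have "2 / sqrt 2 = sqrt (2::real)" by (rule real_div_sqrt) simp
  finally show ?thesis by (simp add: m field_simps)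
qed

text \<open>The vector \<open>cos ((2 i + 1) \<pi> / (2 n))\<close> is the trace on the path of a function on the
  integers that is symmetric about both ends, so that the boundary terms vanish.\<close>
lemma alg_conn_path_graph_le:
  assumes n: "n \<ge> 2"
  shows "alg_conn n (path_graph n) \<le> 2 * (1 - cos (pi / real n))"
proof -
  define \<theta> where "\<theta> = pi / (2 * real n)"
  define f where "f i = cos ((2 * real i + 1) * \<theta>)" for i
  have th: "2 * \<theta> = pi / real n" by (simp add: \<theta>_def)
  have ev: "(\<Sum>j<n. if path_graph n i j then f i - f j else 0) = 2 * (1 - cos (2 * \<theta>)) * f i"
    if i: "i < n" for i
  proof -
    have "(\<Sum>j<n. if path_graph n i j then f i - f j else 0)
        = (\<Sum>j<n. (if j = Suc i then f i - f (Suc i) else 0)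
            + (if j = i - 1 then if i = 0 then 0 else f i - f (i - 1) else 0))"
      using i by (intro sum.cong refl) (auto simp: path_graph_def)
    also have "\<dots> = (if Suc i < n then f i - f (Suc i) else 0) + (if i = 0 then 0 else f i - f (i - 1))"
      using i by (simp add: sum.distrib less_imp_diff_less)
    also have "(if Suc i < n then f i - f (Suc i) else 0) = f i - cos ((2 * real i + 3) * \<theta>)"
    proof (cases "Suc i < n")
      case True
      then show ?thesis by (simp add: f_def algebra_simps)
    next
      case False
      then have "n = Suc i" using i by simp
      then have "2 * (real i + 1) * \<theta> = pi" by (simp add: \<theta>_def field_simps)
      then have "(2 * real i + 1) * \<theta> = pi - \<theta>" "(2 * real i + 3) * \<theta> = pi + \<theta>"
        by (simp_all add: algebra_simps)
      then show ?thesis using False by (simp add: f_def)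
    qed
    also have "(if i = 0 then 0 else f i - f (i - 1)) = f i - cos ((2 * real i - 1) * \<theta>)"
      by (cases i) (simp_all add: f_def algebra_simps)
    finally have "(\<Sum>j<n. if path_graph n i j then f i - f j else 0)
        = 2 * f i - (cos ((2 * real i + 3) * \<theta>) + cos ((2 * real i - 1) * \<theta>))" by simp
    moreover define \<phi> where "\<phi> = (2 * real i + 1) * \<theta>"
    moreover have "(2 * real i + 3) * \<theta> = \<phi> + 2 * \<theta>" "(2 * real i - 1) * \<theta> = \<phi> - 2 * \<theta>"
      by (simp_all add: \<phi>_def algebra_simps)
    moreover have "cos (\<phi> + 2 * \<theta>) + cos (\<phi> - 2 * \<theta>) = 2 * cos \<phi> * cos (2 * \<theta>)"
      unfolding cos_add cos_diff by simp
    ultimately show ?thesis by (simp add: f_def algebra_simps)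
  qed
  have "0 < \<theta>" "\<theta> < pi / 2" using n by (auto simp: \<theta>_def field_simps)
  then have "f 0 \<noteq> 0" using cos_gt_zero[of \<theta>] by (simp add: f_def)
  moreover have "2 * (1 - cos (2 * \<theta>)) > 0"
    using cos_monotone_0_pi[of 0 "2 * \<theta>"] \<open>0 < \<theta>\<close> \<open>\<theta> < pi / 2\<close> by simp
  ultimately show ?thesis
    using alg_conn_le_eigenvalue[OF simple_path_graph, of 0 n f] ev n th by simp
qed

lemma alg_conn_path_graph_le_12:
  assumes n: "n \<ge> 3"
  shows "alg_conn n (path_graph n) \<le> 12 / (real n * (real n + 1))"
proof -
  have "2 * (1 - cos (pi / real n)) \<le> 12 / (real n * (real n + 1))"
  proof (cases "n = 3 \<or> n = 4")
    case True
    have "(7 / 5)\<^sup>2 \<le> (2::real)" by (simp add: power2_eq_square)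
    then have "7 / 5 \<le> sqrt (2::real)" by (rule real_le_rsqrt)
    then show ?thesis using True by (auto simp: cos_45 cos_60)
  next
    case False
    then have n5: "real n \<ge> 5" using n by simp
    have "pi \<le> 3.142" using pi_approx by simp
    then have pi2: "pi * pi \<le> 3.142 * 3.142" by (intro mult_mono) auto
    have "\<bar>sin (pi / (2 * real n))\<bar> \<le> \<bar>pi / (2 * real n)\<bar>" by (rule abs_sin_x_le_abs_x)
    then have "(sin (pi / (2 * real n)))\<^sup>2 \<le> (pi / (2 * real n))\<^sup>2"
      by (simp only: abs_le_square_iff)
    moreover have "cos (pi / real n) = 1 - 2 * (sin (pi / (2 * real n)))\<^sup>2"
      using cos_double_sin[of "pi / (2 * real n)"] by simp
    ultimately have "2 * (1 - cos (pi / real n)) \<le> 4 * (pi / (2 * real n))\<^sup>2" by simp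
    also have "\<dots> = pi * pi / (real n * real n)" by (simp add: power2_eq_square)
    also have "\<dots> \<le> 12 / (real n * (real n + 1))"
    proof -
      have "pi * pi * (real n + 1) \<le> 9.9 * (real n + 1)"
        using pi2 by (intro mult_right_mono) auto
      also have "\<dots> \<le> 12 * real n" using n5 by simp
      finally have "pi * pi * (real n + 1) / (real n * real n * (real n + 1))
          \<le> 12 * real n / (real n * real n * (real n + 1))"
        by (intro divide_right_mono) auto
      then show ?thesis using n5 by simp
    qed
    finally show ?thesis .
  qed
  then show ?thesis using alg_conn_path_graph_le[of n] n by simp
qed

lemma randic_alg_conn_path_graph_le:
  assumes "n \<ge> 3"
  shows "randic n (path_graph n) * alg_conn n (path_graph n)
    \<le> 6 * (real n - 3 + 2 * sqrt 2) / (real n * (real n + 1))"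
proof -
  have "randic n (path_graph n) * alg_conn n (path_graph n)
      \<le> (real n - 3 + 2 * sqrt 2) / 2 * (12 / (real n * (real n + 1)))"
    unfolding randic_path_graph[OF assms]
    using assms by (intro mult_left_mono alg_conn_path_graph_le_12) auto
  moreover have "x / 2 * (12 / y) = 6 * x / y" for x y :: real by simp
  ultimately show ?thesis by metis
qed

section \<open>Minimum degree close to half the order\<close>

lemma alg_conn_ge_path_4:
  assumes G: "simple_graph 4 E" and d: "distinct [u, p, q, v]"
    and e: "E u p" "E p q" "E q v"
  shows "2 - sqrt 2 \<le> alg_conn 4 E"
proof (rule alg_conn_ge[OF G])
  fix f :: "nat \<Rightarrow> real" assume f0: "(\<Sum>i<4. f i) = 0"
  have "{u, p, q, v} \<subseteq> {..<4}" using simple_graphD(1,2)[OF G] e by blast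
  moreover have "card {u, p, q, v} = card {..<4::nat}" using d by simp
  ultimately have V: "{..<4} = {u, p, q, v}" by (metis card_subset_eq finite_lessThan)
  define s a b where "s = (f u + f v) / 2" and "a = (f u - f v) / 2" and "b = (f p - f q) / 2"
  have "f u + f p + f q + f v = 0" using f0 d unfolding V by simp
  then have f: "f u = s + a" "f v = s - a" "f p = b - s" "f q = - b - s"
    by (auto simp: s_def a_def b_def field_simps)
  have "(2 - sqrt 2) * (\<Sum>i<4. (f i)\<^sup>2) = (2 - sqrt 2) * (4 * s\<^sup>2 + 2 * a\<^sup>2 + 2 * b\<^sup>2)"
    using d unfolding V by (simp add: f power2_eq_square algebra_simps)
  also have "\<dots> \<le> (2 - sqrt 2) * (4 * s\<^sup>2 + 2 * a\<^sup>2 + 2 * b\<^sup>2)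
      + (4 * sqrt 2 * s\<^sup>2 + (2 * sqrt 2 - 2) * (a - (1 + sqrt 2) * b)\<^sup>2)"
    by simp
  also have "\<dots> = 8 * s\<^sup>2 + 2 * (a - b)\<^sup>2 + 4 * b\<^sup>2"
  proof -
    have "(2 - r) * (4 * s\<^sup>2 + 2 * a\<^sup>2 + 2 * b\<^sup>2)
      + (4 * r * s\<^sup>2 + (2 * r - 2) * (a - (1 + r) * b)\<^sup>2) = 8 * s\<^sup>2 + 2 * (a - b)\<^sup>2 + 4 * b\<^sup>2
      + (r * r - 2) * (2 * (1 + r) * (b * b) - 4 * a * b)"
      for r :: real by (simp add: power2_eq_square algebra_simps)
    from this[of "sqrt 2"] show ?thesis by simp
  qed
  also have "\<dots> = (\<Sum>(x,y)\<in>{(u,p),(p,q),(q,v)}. (f x - f y)\<^sup>2)"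
    using d by (simp add: f power2_eq_square algebra_simps)
  also have "\<dots> \<le> dirichlet 4 E f"
    using d e by (intro dirichlet_ge_arcs[OF G]) auto
  finally show "(2 - sqrt 2) * (\<Sum>i<4. (f i)\<^sup>2) \<le> dirichlet 4 E f" .
qed simp

text \<open>Closed neighbourhoods of vertices at distance at least 3 are disjoint, hence partition the
  vertex set when all degrees are at least \<open>n / 2 - 1\<close>.\<close>
lemma far_apart_vertices:
  assumes G: "simple_graph n E" and c: "connected_graph n E"
    and half: "\<forall>w<n. n \<le> 2 * deg n E w + 2"
    and uv: "u < n" "v < n" "u \<noteq> v" and far: "\<not> E u v" "\<nexists>w. E u w \<and> E w v"
  shows "\<exists>p q. E u p \<and> E p q \<and> E q v"
    and "\<And>w. w < n \<Longrightarrow> deg n E w \<le> n - 2"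
    and "deg n E u + deg n E v + 2 \<le> n"
proof -
  note sg = simple_graphD[OF G]
  let ?N = "\<lambda>x. insert x {w. w < n \<and> E x w}"
  have card: "card (?N x) = deg n E x + 1" for x
    using sg(4) by (simp add: deg_def)
  have disj: "?N u \<inter> ?N v = {}" using uv far sg(3) by auto
  have sub: "?N u \<union> ?N v \<subseteq> {..<n}" using uv by auto
  have cardU: "card (?N u \<union> ?N v) = deg n E u + deg n E v + 2"
    using disj by (subst card_Un_disjoint) (auto simp: card)
  show le: "deg n E u + deg n E v + 2 \<le> n"
    using card_mono[OF _ sub] cardU by simp
  have "card (?N u \<union> ?N v) = card {..<n}"
    using cardU le half[rule_format, OF uv(1)] half[rule_format, OF uv(2)] by simp
  then have U: "?N u \<union> ?N v = {..<n}" using sub by (metis card_subset_eq finite_lessThan)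
  have "v \<notin> ?N u" using disj by blast
  then obtain p q where pq: "p \<in> ?N u" "q \<notin> ?N u" "E p q"
    using connected_crossing_edge[OF c uv(1,2), of "?N u"] by blast
  have "q \<in> ?N v" using pq sg(2) U by blast
  moreover have "p \<noteq> u" using pq sg(2) by auto
  moreover have "q \<noteq> v" using calculation pq far by auto
  ultimately have "E u p" "E p q" "E q v" using pq sg(3)[of v q] by auto
  then show "\<exists>p q. E u p \<and> E p q \<and> E q v" by blast
  show "deg n E w \<le> n - 2" if w: "w < n" for w
  proof -
    obtain y where y: "y < n" "y \<noteq> w" "\<not> E w y"
      using uv far sg(3) by metis
    have "deg n E w \<le> card ({..<n} - {w, y})"
      unfolding deg_def by (rule card_mono) (use y sg(4) in auto)
    then show ?thesis using w y by (simp add: card_Diff_subset)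
  qed
qed

lemma path_bound_le_distance_2_bound:
  assumes "n \<ge> (4::nat)"
  shows "6 * (real n - 3 + 2 * sqrt 2) / (real n * (real n + 1)) \<le> sqrt (real n - 1) * (2 / (real n - 1))"
proof (cases "n = 4")
  case True
  have "sqrt 2 \<le> 1.4143" by (rule real_le_lsqrt) (auto simp: power2_eq_square)
  moreover have "1.732 \<le> sqrt (3::real)" by (rule real_le_rsqrt) (auto simp: power2_eq_square)
  ultimately show ?thesis using True by simp
next
  case False
  then have n: "real n \<ge> 5" using assms by simp
  define s where "s = sqrt (real n - 1)"
  have s: "s > 0" "real n - 1 = s * s" using n by (auto simp: s_def)
  have "0 \<le> (real n - 2) * (real n - 5)" using n by simp
  then have "(3 * s)\<^sup>2 \<le> (real n + 1)\<^sup>2" using s(2) by (simp add: power2_eq_square algebra_simps)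
  then have sn: "3 * s \<le> real n + 1" by (rule power2_le_imp_le) simp
  have "sqrt 2 \<le> 3 / 2" by (rule real_le_lsqrt) (auto simp: power2_eq_square)
  then have "6 * (real n - 3 + 2 * sqrt 2) / (real n * (real n + 1))
      \<le> 6 * real n / (real n * (real n + 1))"
    using n by (intro divide_right_mono) auto
  also have "\<dots> = 6 / (real n + 1)" using n by simp
  also have "\<dots> \<le> 6 / (3 * s)" using sn s n by (intro divide_left_mono) auto
  also have "\<dots> = s * (2 / (s * s))" using s by simp
  finally show ?thesis by (simp add: s(2)[symmetric] s_def[symmetric])
qed

lemma path_bound_le_distance_3_bound:
  assumes "n \<ge> (6::nat)"
  shows "6 * (real n - 3 + 2 * sqrt 2) / (real n * (real n + 1))
    \<le> real n * (sqrt 2 / (1 + 2)) * (4 / (3 * real n - 5))"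
proof -
  define x where "x = real n"
  have x: "x \<ge> 6" using assms by (simp add: x_def)
  have r: "1.4142 \<le> sqrt (2::real)" "sqrt 2 \<le> 1.4143"
    by (rule real_le_rsqrt real_le_lsqrt; simp add: power2_eq_square)+
  have "18 * (x - 3 + 2 * sqrt 2) * (3 * x - 5) \<le> 18 * (x - 0.1714) * (3 * x - 5)"
    using r x by (intro mult_right_mono mult_left_mono) auto
  also have "\<dots> \<le> 4 * 1.4142 * (x * x * (x + 1))"
  proof -
    define y where "y = x - 6"
    have y: "y \<ge> 0" "x = y + 6" using x by (auto simp: y_def)
    have "4 * 1.4142 * (x * x * (x + 1)) - 18 * (x - 0.1714) * (3 * x - 5)
      = 5.6568 * (y * y * y) + 53.4792 * (y * y) + 130.0716 * y + 61.6212"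
      unfolding y(2) by (simp add: field_simps)
    also have "\<dots> \<ge> 0" using y(1) by (intro add_nonneg_nonneg) auto
    finally show ?thesis by simp
  qed
  also have "\<dots> \<le> 4 * sqrt 2 * (x * x * (x + 1))"
    using r x by (intro mult_right_mono) auto
  finally have "18 * (x - 3 + 2 * sqrt 2) * (3 * x - 5) \<le> 4 * sqrt 2 * (x * x * (x + 1))" .
  then have "18 * (x - 3 + 2 * sqrt 2) * (3 * x - 5) / (3 * x * (x + 1) * (3 * x - 5))
      \<le> 4 * sqrt 2 * (x * x * (x + 1)) / (3 * x * (x + 1) * (3 * x - 5))"
    using x by (intro divide_right_mono) auto
  also have "18 * (x - 3 + 2 * sqrt 2) * (3 * x - 5) / (3 * x * (x + 1) * (3 * x - 5))
      = 6 * (x - 3 + 2 * sqrt 2) / (x * (x + 1))"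
    using x by (simp add: divide_simps) (simp add: algebra_simps)
  also have "4 * sqrt 2 * (x * x * (x + 1)) / (3 * x * (x + 1) * (3 * x - 5))
      = x * (sqrt 2 / (1 + 2)) * (4 / (3 * x - 5))"
    using x by (simp add: divide_simps)
  finally show ?thesis by (simp add: x_def)
qed

section \<open>Products of the Randic index and the algebraic connectivity\<close>

lemma diameter_pos:
  assumes c: "connected_graph n E" and n: "n \<ge> 2"
  shows "diameter n E > 0"
proof -
  have "0 < n" "1 < n" using n by auto
  then obtain xs where "walk n E xs" and xs: "hd xs = 0" "last xs = 1"
      "length xs = Suc (gdist n E 0 1)" and "distinct xs"
    by (rule geodesic_exists[OF c])
  have "gdist n E 0 1 \<noteq> 0"
  proof
    assume "gdist n E 0 1 = 0"
    then have "length xs = Suc 0" by (simp only: xs(3))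
    then obtain x where "xs = [x]" by (metis length_0_conv length_Suc_conv)
    then show False using xs(1,2) by simp
  qed
  then show ?thesis using gdist_le_diameter[OF \<open>0 < n\<close> \<open>1 < n\<close>, of E] by linarith
qed

lemma randic_alg_conn_ge_diameter:
  assumes G: "simple_graph n E" and c: "connected_graph n E" and n: "n \<ge> 3"
  shows "8 * sqrt (real n - 1) / (real n * (real (diameter n E))\<^sup>2) \<le> randic n E * alg_conn n E"
proof -
  define D where "D = diameter n E"
  have D: "D > 0" using diameter_pos[OF c] n by (simp add: D_def)
  have R: "sqrt (real n - 1) \<le> randic n E"
    using randic_ge_sqrt[OF G] connected_deg_pos[OF G c] n by simp
  have a: "8 / (real n * (real D)\<^sup>2) \<le> alg_conn n E"
  proof (cases "D = 1")
    case True
    then have "deg n E u = n - 1" if "u < n" for u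
      using diameter_1_deg[OF G c _ that] by (simp add: D_def)
    then have "2 * (real n - 1) - real n + 2 \<le> alg_conn n E"
      using n by (intro alg_conn_ge_min_degree[OF G]) auto
    moreover have "8 / real n \<le> real n"
    proof -
      have "3 * 3 \<le> real n * real n" using n by (intro mult_mono) auto
      then show ?thesis using n by (simp add: field_simps)
    qed
    ultimately show ?thesis using True by simp
  next
    case False
    then have D2: "real D \<ge> 2" using D by simp
    have "8 / (real n * (real D)\<^sup>2) = (4 / (real n * real D)) * (2 / real D)"
      by (simp add: power2_eq_square)
    also have "\<dots> \<le> (4 / (real n * real D)) * 1"
      using D2 by (intro mult_left_mono) auto
    also have "\<dots> \<le> alg_conn n E"
      using alg_conn_ge_diameter[OF G c] n D by (simp add: D_def)
    finally show ?thesis .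
  qed
  have "8 * sqrt (real n - 1) / (real n * (real D)\<^sup>2) = sqrt (real n - 1) * (8 / (real n * (real D)\<^sup>2))"
    by simp
  also have "\<dots> \<le> randic n E * alg_conn n E"
    using R a n by (intro mult_mono) (auto intro: order_trans[OF _ R])
  finally show ?thesis by (simp add: D_def)
qed

lemma alg_conn_nonneg:
  assumes "simple_graph n E" "n \<ge> 2"
  shows "alg_conn n E \<ge> 0"
  by (rule alg_conn_ge[OF assms]) (simp add: edge_sum_nonneg)

lemma randic_alg_conn_ge_min_degree:
  assumes G: "simple_graph n E" and c: "connected_graph n E" and n: "n \<ge> 3"
  defines "\<delta> \<equiv> real (min_degree n E)"
  shows "real n * \<delta> * (2 * \<delta> - real n + 2) / (2 * (real n - 1)) \<le> randic n E * alg_conn n E"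
proof -
  have \<delta>: "\<And>u. u < n \<Longrightarrow> \<delta> \<le> real (deg n E u)" by (simp add: \<delta>_def min_degree_le)
  note pos = connected_deg_pos[OF G c]
  have R: "real n * \<delta> / (2 * (real n - 1)) \<le> randic n E"
    using randic_ge_min_degree[OF G _ _ \<delta>] pos n by simp
  have a: "2 * \<delta> - real n + 2 \<le> alg_conn n E"
    using alg_conn_ge_min_degree[OF G _ \<delta>] n by simp
  have nn: "0 \<le> real n * \<delta> / (2 * (real n - 1))" using n by (simp add: \<delta>_def)
  have "real n * \<delta> * (2 * \<delta> - real n + 2) / (2 * (real n - 1))
      = real n * \<delta> / (2 * (real n - 1)) * (2 * \<delta> - real n + 2)" by simp
  also have "\<dots> \<le> real n * \<delta> / (2 * (real n - 1)) * alg_conn n E"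
    using a nn by (rule mult_left_mono)
  also have "\<dots> \<le> randic n E * alg_conn n E"
    using R alg_conn_nonneg[OF G] n by (intro mult_right_mono) auto
  finally show ?thesis .
qed

lemma path_graph_minimizes_diameter:
  assumes G: "simple_graph n E" and c: "connected_graph n E" and n: "n \<ge> 3"
    and D: "real (diameter n E) \<le> (real n - 1) powr (1/4)"
  shows "randic n (path_graph n) * alg_conn n (path_graph n) \<le> randic n E * alg_conn n E"
proof -
  let ?D = "real (diameter n E)"
  have pos: "?D > 0" using diameter_pos[OF c] n by simp
  have "?D\<^sup>2 \<le> ((real n - 1) powr (1/4))\<^sup>2"
    using D by (intro power_mono) auto
  also have "\<dots> = sqrt (real n - 1)"
    using n by (simp add: power2_eq_square powr_add[symmetric] powr_half_sqrt)
  finally have D2: "?D\<^sup>2 \<le> sqrt (real n - 1)" .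
  have "sqrt 2 \<le> 3 / 2" by (rule real_le_lsqrt) (auto simp: power2_eq_square)
  then have "6 * (real n - 3 + 2 * sqrt 2) / (real n * (real n + 1)) \<le> 8 * (real n + 1) / (real n * (real n + 1))"
    using n by (intro divide_right_mono) auto
  also have "\<dots> = 8 / real n" by (rule nonzero_mult_divide_mult_cancel_right) simp
  also have "\<dots> = 8 * ?D\<^sup>2 / (real n * ?D\<^sup>2)" using pos by simp
  also have "\<dots> \<le> 8 * sqrt (real n - 1) / (real n * ?D\<^sup>2)"
    using D2 by (intro divide_right_mono) auto
  finally show ?thesis
    using randic_alg_conn_path_graph_le[OF n] randic_alg_conn_ge_diameter[OF G c n] by linarith
qed

text \<open>In the boundary case \<open>\<delta> = n / 2 - 1\<close> the degree bound on the algebraic connectivity is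
  vacuous. Then either any two vertices have distance at most 2, or two closed neighbourhoods
  partition the graph; for \<open>n = 4\<close> the latter graph is the path itself.\<close>
lemma path_graph_minimizes_half:
  assumes G: "simple_graph n E" and c: "connected_graph n E" and n: "n \<ge> 4" "even n"
    and half: "\<forall>w<n. n \<le> 2 * deg n E w + 2"
  shows "randic n (path_graph n) * alg_conn n (path_graph n) \<le> randic n E * alg_conn n E"
proof -
  have n3: "n \<ge> 3" and n2: "n \<ge> 2" using n by auto
  note pos = connected_deg_pos[OF G c n2]
  note path = randic_alg_conn_path_graph_le[OF n3]
  have R: "sqrt (real n - 1) \<le> randic n E" by (rule randic_ge_sqrt[OF G n2 pos])
  have R0: "0 \<le> randic n E" using R n by (intro order_trans[OF _ R]) simp
  show ?thesis
  proof (cases "\<forall>u<n. \<forall>v<n. u \<noteq> v \<longrightarrow> E u v \<or> (\<exists>w. E u w \<and> E w v)")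
    case True
    then have "2 / (real n - 1) \<le> alg_conn n E"
      by (intro alg_conn_ge_distance_2[OF G n3]) simp
    then have "sqrt (real n - 1) * (2 / (real n - 1)) \<le> randic n E * alg_conn n E"
      using R R0 n by (intro mult_mono) auto
    then show ?thesis using path path_bound_le_distance_2_bound[OF n(1)] by linarith
  next
    case False
    then obtain u v where uv: "u < n" "v < n" "u \<noteq> v" "\<not> E u v" "\<nexists>w. E u w \<and> E w v"
      by blast
    note far = far_apart_vertices[OF G c half]
    from far(1)[OF uv] obtain p q where pq: "E u p" "E p q" "E q v" by blast
    have pqn: "p < n" "q < n" using pq simple_graphD(1)[OF G] by blast+
    show ?thesis
    proof (cases "n = 4")
      case True
      have d: "distinct [u, p, q, v]" using uv pq simple_graphD[OF G] by auto
      have "2 - sqrt 2 \<le> alg_conn n E"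
        using alg_conn_ge_path_4[OF _ d pq] G True by simp
      moreover have "(1 + 2 * sqrt 2) / 2 \<le> randic n E"
      proof -
        let ?w = "\<lambda>x y. 1 / sqrt (real (deg n E x) * real (deg n E y))"
        have w: "1 / sqrt c \<le> ?w x y"
          if "x < n" "y < n" "real (deg n E x) \<le> a" "real (deg n E y) \<le> b" "a * b = c" for x y a b c
        proof -
          have "sqrt (real (deg n E x) * real (deg n E y)) \<le> sqrt c"
            unfolding that(5)[symmetric] using that by (intro real_sqrt_le_mono mult_mono) auto
          then show ?thesis using pos[OF that(1)] pos[OF that(2)] by (intro frac_le) auto
        qed
        have du: "real (deg n E u) \<le> 1" "real (deg n E v) \<le> 1"
          using far(3)[OF uv] pos[OF uv(1)] pos[OF uv(2)] True by auto
        have dp: "real (deg n E p) \<le> 2" "real (deg n E q) \<le> 2"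
          using far(2)[OF uv pqn(1)] far(2)[OF uv pqn(2)] True by auto
        have "(1 + 2 * sqrt 2) / 2 = 1 / sqrt 2 + 1 / sqrt 4 + 1 / sqrt (2::real)"
          using real_div_sqrt[of 2] by (simp add: field_simps)
        also have "\<dots> \<le> ?w u p + ?w p q + ?w q v"
          using du dp uv(1,2) pqn w[of u p 1 2 2] w[of p q 2 2 4] w[of q v 2 1 2]
          by (intro add_mono) simp_all
        also have "\<dots> = (\<Sum>(x,y)\<in>{(u,p),(p,q),(q,v)}. ?w x y)" using d by simp
        also have "\<dots> \<le> randic n E"
          unfolding randic_eq_edge_sum using d pq
          by (intro edge_sum_ge_arcs[OF G]) (auto simp: mult.commute)
        finally show ?thesis .
      qed
      moreover have "sqrt 2 \<le> (2::real)" by (rule real_le_lsqrt) auto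
      ultimately have "(1 + 2 * sqrt 2) / 2 * (2 - sqrt 2) \<le> randic n E * alg_conn n E"
        using R0 by (intro mult_mono) auto
      moreover have "randic n (path_graph n) * alg_conn n (path_graph n)
          \<le> (1 + 2 * sqrt 2) / 2 * (2 - sqrt 2)"
        unfolding randic_path_graph[OF n3] using alg_conn_path_graph_le[OF n2] True
        by (intro mult_mono) (auto simp: cos_45 alg_conn_nonneg[OF simple_path_graph])
      ultimately show ?thesis by linarith
    next
      case False
      with n have n6: "n \<ge> 6" by presburger
      have a: "4 / (3 * real n - 5) \<le> alg_conn n E"
      proof (rule alg_conn_ge_distance_3[OF G n3])
        fix x y assume xy: "x < n" "y < n" "x \<noteq> y"
        show "E x y \<or> (\<exists>w. E x w \<and> E w y) \<or> (\<exists>p q. E x p \<and> E p q \<and> E q y)"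
          using far(1)[OF xy] by (cases "E x y \<or> (\<exists>w. E x w \<and> E w y)") auto
      qed
      have "real n * (sqrt 2 / (1 + 2)) \<le> randic n E"
      proof (rule randic_ge_ratio[OF G _ pos])
        fix x y assume "x < n" "y < n"
        then have "deg n E x \<le> n - 2" "n \<le> 2 * deg n E y + 2"
          using far(2)[OF uv] half by simp_all
        then have "deg n E x \<le> 2 * deg n E y" by simp
        then show "real (deg n E x) \<le> 2 * real (deg n E y)" by linarith
      qed simp_all
      then have "real n * (sqrt 2 / (1 + 2)) * (4 / (3 * real n - 5)) \<le> randic n E * alg_conn n E"
        using a R0 n by (intro mult_mono) auto
      then show ?thesis using path path_bound_le_distance_3_bound[OF n6] by linarith
    qed
  qed
qed

lemma path_graph_minimizes_min_degree:
  assumes G: "simple_graph n E" and c: "connected_graph n E" and n: "n \<ge> 3"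
    and half: "real (min_degree n E) \<ge> real n / 2 - 1"
  shows "randic n (path_graph n) * alg_conn n (path_graph n) \<le> randic n E * alg_conn n E"
proof (cases "n \<le> 2 * min_degree n E + 1")
  case True
  have "2 * real (min_degree n E) - real n + 2 \<le> alg_conn n E"
    using n by (intro alg_conn_ge_min_degree[OF G]) (auto simp: min_degree_le)
  then have a: "1 \<le> alg_conn n E" using True by linarith
  have R: "sqrt (real n - 1) \<le> randic n E"
    using randic_ge_sqrt[OF G] connected_deg_pos[OF G c] n by simp
  have "6 * (real n - 3 + 2 * sqrt 2) / (real n * (real n + 1)) \<le> sqrt (real n - 1)"
  proof (cases "n = 3")
    case True
    then show ?thesis by simp
  next
    case False
    then have n4: "n \<ge> 4" using n by simp
    have "sqrt (real n - 1) * (2 / (real n - 1)) \<le> sqrt (real n - 1) * 1"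
      using n4 by (intro mult_left_mono) auto
    then show ?thesis using path_bound_le_distance_2_bound[OF n4] by linarith
  qed
  also have "\<dots> \<le> randic n E * 1" using R by simp
  also have "\<dots> \<le> randic n E * alg_conn n E"
    using a n by (intro mult_left_mono) (auto intro: order_trans[OF _ R])
  finally show ?thesis using randic_alg_conn_path_graph_le[OF n] by linarith
next
  case False
  then have eq: "n = 2 * min_degree n E + 2" using half by linarith
  show ?thesis
  proof (rule path_graph_minimizes_half[OF G c])
    show "n \<ge> 4" "even n" using eq n by presburger+
    show "\<forall>w<n. n \<le> 2 * deg n E w + 2"
    proof (intro allI impI)
      fix w assume "w < n"
      from min_degree_le[OF this, of E] show "n \<le> 2 * deg n E w + 2" using eq by linarith
    qed
  qed
qed

theorem theorem2p8:
  fixes n :: nat and E :: "nat \<Rightarrow> nat \<Rightarrow> bool"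
  assumes "n \<ge> 3" and "simple_graph n E" and "connected_graph n E"
  defines "R \<equiv> randic n E" and "a \<equiv> alg_conn n E"
      and "D \<equiv> real (diameter n E)" and "\<delta> \<equiv> real (min_degree n E)"
  shows "R * a \<ge> 8 * sqrt (real n - 1) / (real n * D ^ 2)
    \<and> R * a \<ge> real n * \<delta> * (2 * \<delta> - real n + 2) / (2 * (real n - 1))
    \<and> ((D \<le> (real n - 1) powr (1/4) \<or> \<delta> \<ge> real n / 2 - 1) \<longrightarrow>
           R * a \<ge> randic n (path_graph n) * alg_conn n (path_graph n))"
  unfolding R_def a_def D_def \<delta>_def
proof (intro conjI impI)
  note G = assms(2) and c = assms(3) and n = assms(1)
  show "8 * sqrt (real n - 1) / (real n * (real (diameter n E))\<^sup>2) \<le> randic n E * alg_conn n E"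
    by (rule randic_alg_conn_ge_diameter[OF G c n])
  show "real n * real (min_degree n E) * (2 * real (min_degree n E) - real n + 2) / (2 * (real n - 1))
      \<le> randic n E * alg_conn n E"
    by (rule randic_alg_conn_ge_min_degree[OF G c n])
  assume "real (diameter n E) \<le> (real n - 1) powr (1/4) \<or> real n / 2 - 1 \<le> real (min_degree n E)"
  then show "randic n (path_graph n) * alg_conn n (path_graph n) \<le> randic n E * alg_conn n E"
    using path_graph_minimizes_diameter[OF G c n] path_graph_minimizes_min_degree[OF G c n] by auto
qed

end
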